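(* Suppose that the endowments are $w_i=\frac1m$ for all $i\in\mathcal I$, and that the best responses are independent and identically distributed with diminishing variance $\Sigma=\mathrm{var}(\gamma_i)$: there exists $g>0$ such that $\lambda_{\max}(\Sigma)=O(\frac1{n^g})$. If $n>\left(\frac{2\Omega}{\epsilon_H}\right)^{1/g}$ and $$m\ge\frac{8\sqrt2\,(\Omega^2\lambda_{\max}(\Sigma)+0.5\,\Omega\,\epsilon_H)}{\epsilon_H^2}\log\left(\frac{2n}{\delta}\right),$$ then $0\preceq\widetilde H(p)-H(p)\preceq\epsilon_HI$ holds with probability at least $1-\delta$.
   Context: A market has $n$ goods and players $i\in\mathcal I=\{1,\dots,m\}$ with budgets $w_i$ and utilities $u_i\in\mathcal A^{k_i,r_i}$, $r_i<1$, i.e. $u_i(x)=(\sum_j\theta_{ij}(x^{(j)}))^{k_i}$ with each $\theta_{ij}$ nonnegative, continuous and homogeneous of order $r_i$, and $d_i=k_ir_i>0$. At a price vector $p>0$, $x_i(p)$ is the best response (maximizer of $u_i(x)$ over $x\in\mathbb R^n_+$, $\langle p,x\rangle\le w_i$), $\gamma_i=\mathrm{diag}(p)x_i(p)/w_i$ is the bidding vector (a point of the unit simplex), and $\Gamma_i=\mathrm{diag}(\gamma_i)$. The affine-scaled Hessian of the market potential is $$H(p)=\sum_{i}\frac{w_i}{1-r_i}\Gamma_i-\sum_i\frac{w_ir_i}{1-r_i}\gamma_i\gamma_i^\top.$$ Its diagonal-plus-rank-one (DR1) approximation is $$\widetilde H(p)=\sum_i\frac{w_i}{1-r_i}\Gamma_i-\Omega\,\xi\xi^\top,\quad\Omega=\sum_i\frac{w_ir_i}{1-r_i},\quad\omega_i=\Omega^{-1}\frac{w_ir_i}{1-r_i},\quad\xi=\sum_i\omega_i\gamma_i.$$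 Here $\epsilon_H>0$ is the accuracy, $\delta\in(0,1)$, $\mathrm{var}(\gamma_i)$ is the covariance matrix of the random vector $\gamma_i$, $\lambda_{\max}$ is the largest eigenvalue, and $\preceq$ is the Loewner order.
   Formalization: All r_i are in (0,1); O(1/n^g) is read as ≤ C/n^g and the threshold as n > (2CΩ/ε_H)^{1/g}; with ω_i ≤ κ/m the bound on m is multiplied by κ (κ=1 for equal r_i). The claim fails for negative r_i, for large C, and for concentrated ω_i. *)

theory Defs
  imports "HOL-Probability.Probability"
begin

section \<open>Symmetric matrices\<close>

definition diag_matrix :: "real ^ 'n \<Rightarrow> real ^ 'n ^ 'n" where
  "diag_matrix v = (\<chi> i j. if i = j then v $ i else 0)"

definition outer :: "real ^ 'n \<Rightarrow> real ^ 'n \<Rightarrow> real ^ 'n ^ 'n" where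
  "outer a b = (\<chi> i j. a $ i * b $ j)"

definition psd :: "real ^ 'n ^ 'n \<Rightarrow> bool" where
  "psd A \<longleftrightarrow> transpose A = A \<and> (\<forall>x. 0 \<le> x \<bullet> (A *v x))"

definition loewner_le :: "real ^ 'n ^ 'n \<Rightarrow> real ^ 'n ^ 'n \<Rightarrow> bool"  (infix "\<preceq>\<^sub>L" 50) where
  "A \<preceq>\<^sub>L B \<longleftrightarrow> psd (B - A)"

text \<open>Meaningful for symmetric matrices, whose set of real eigenvalues is finite and nonempty.\<close>

definition lambda_max :: "real ^ 'n ^ 'n \<Rightarrow> real" where
  "lambda_max A = Max {l. \<exists>v. v \<noteq> 0 \<and> A *v v = l *\<^sub>R v}"

definition covariance_matrix :: "'s measure \<Rightarrow> ('s \<Rightarrow> real ^ 'n) \<Rightarrow> real ^ 'n ^ 'n" where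
  "covariance_matrix M Y = (\<chi> a b. integral\<^sup>L M (\<lambda>s.
     (Y s $ a - integral\<^sup>L M (\<lambda>t. Y t $ a)) * (Y s $ b - integral\<^sup>L M (\<lambda>t. Y t $ b))))"

section \<open>Fisher markets\<close>

definition nonneg_orthant :: "(real ^ 'n) set" where
  "nonneg_orthant = {x. \<forall>j. 0 \<le> x $ j}"

text \<open>
  The class of utilities \<open>(\<Sum>j. \<theta> j (x $ j)) powr k\<close> with every \<open>\<theta> j\<close> homogeneous of
  order \<open>r\<close>. The \<open>\<theta> j\<close> are real-valued on the closed half-line, which is the right domain for
  \<open>r > 0\<close>; for \<open>r < 0\<close> they would have to take the value infinity at the origin.
\<close>

definition utility_class :: "real \<Rightarrow> real \<Rightarrow> (real ^ 'n \<Rightarrow> real) set" where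
  "utility_class k r = {u. \<exists>\<theta> :: 'n \<Rightarrow> real \<Rightarrow> real.
     (\<forall>j. continuous_on {0..} (\<theta> j)
        \<and> (\<forall>x\<ge>0. 0 \<le> \<theta> j x)
        \<and> (\<forall>t>0. \<forall>x\<ge>0. \<theta> j (t * x) = t powr r * \<theta> j x))
     \<and> (\<forall>x\<in>nonneg_orthant. u x = (\<Sum>j\<in>UNIV. \<theta> j (x $ j)) powr k)}"

definition best_response :: "(real ^ 'n \<Rightarrow> real) \<Rightarrow> real ^ 'n \<Rightarrow> real \<Rightarrow> real ^ 'n \<Rightarrow> bool" where
  "best_response u p w x \<longleftrightarrow> is_arg_max u (\<lambda>y. y \<in> nonneg_orthant \<and> p \<bullet> y \<le> w) x"

definition bidding :: "real ^ 'n \<Rightarrow> real \<Rightarrow> real ^ 'n \<Rightarrow> real ^ 'n" where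
  "bidding p w x = (1 / w) *\<^sub>R (diag_matrix p *v x)"

text \<open>
  Below, \<open>w\<close>, \<open>r\<close> and \<open>\<gamma>\<close> are the families of budgets, homogeneity orders and bidding
  vectors (the price enters only through \<open>\<gamma>\<close>).
\<close>

definition Omega :: "('m::finite \<Rightarrow> real) \<Rightarrow> ('m \<Rightarrow> real) \<Rightarrow> real" where
  "Omega w r = (\<Sum>i\<in>UNIV. w i * r i / (1 - r i))"

definition omega :: "('m::finite \<Rightarrow> real) \<Rightarrow> ('m \<Rightarrow> real) \<Rightarrow> 'm \<Rightarrow> real" where
  "omega w r i = inverse (Omega w r) * (w i * r i / (1 - r i))"

definition xi :: "('m::finite \<Rightarrow> real) \<Rightarrow> ('m \<Rightarrow> real) \<Rightarrow> ('m \<Rightarrow> real ^ 'n) \<Rightarrow> real ^ 'n" where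
  "xi w r \<gamma> = (\<Sum>i\<in>UNIV. omega w r i *\<^sub>R \<gamma> i)"

definition scaled_hessian ::
  "('m::finite \<Rightarrow> real) \<Rightarrow> ('m \<Rightarrow> real) \<Rightarrow> ('m \<Rightarrow> real ^ 'n) \<Rightarrow> real ^ 'n ^ 'n" where
  "scaled_hessian w r \<gamma> =
     (\<Sum>i\<in>UNIV. (w i / (1 - r i)) *\<^sub>R diag_matrix (\<gamma> i))
     - (\<Sum>i\<in>UNIV. (w i * r i / (1 - r i)) *\<^sub>R outer (\<gamma> i) (\<gamma> i))"

definition dr1_hessian ::
  "('m::finite \<Rightarrow> real) \<Rightarrow> ('m \<Rightarrow> real) \<Rightarrow> ('m \<Rightarrow> real ^ 'n) \<Rightarrow> real ^ 'n ^ 'n" where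
  "dr1_hessian w r \<gamma> =
     (\<Sum>i\<in>UNIV. (w i / (1 - r i)) *\<^sub>R diag_matrix (\<gamma> i))
     - Omega w r *\<^sub>R outer (xi w r \<gamma>) (xi w r \<gamma>)"

end

theory Submission
  imports Defs
begin

text \<open>
  The difference \<open>H\<^sub>D - H\<close> of the approximate and the exact Hessian is \<open>\<Omega>\<close> times the covariance matrix
  of the bids \<open>\<gamma>\<^sub>i\<close> under the weights \<open>\<omega>\<^sub>i\<close>, so it is positive semidefinite for every outcome. A
  weighted covariance only grows when it is centred at another point, hence
  \<open>H\<^sub>D - H \<preceq>\<^sub>L \<Omega> S\<close> with \<open>S = \<Sum>\<^sub>i \<omega>\<^sub>i (\<gamma>\<^sub>i - \<mu>)(\<gamma>\<^sub>i - \<mu>)\<^sup>T\<close> and \<open>\<mu>\<close> the common mean of the bids.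
  The matrix \<open>S\<close> is a sum of independent rank-one matrices with expectation \<open>\<Sigma>\<close>. The bound on the
  number of goods gives \<open>\<lambda>\<^sub>m\<^sub>a\<^sub>x(\<Sigma>) \<le> \<epsilon> / (2\<Omega>)\<close>, so it remains to bound the probability that the
  largest eigenvalue of \<open>S\<close> exceeds \<open>\<epsilon> / \<Omega>\<close>, at least twice that of its expectation.

  This is a matrix Chernoff bound (\<open>rank_one_matrix_chernoff\<close>). It needs control of
  \<open>tr exp(A + v v\<^sup>T)\<close> by \<open>tr exp A\<close>, which usually comes from the Golden-Thompson inequality. For
  a rank-one increment of a positive semidefinite \<open>A\<close> there is an elementary substitute. Let
  \<open>D = A + v v\<^sup>T\<close>, \<open>v\<^sup>T v \<le> c\<close>, and let \<open>L f = v\<^sup>T f(A) v\<close>. In an eigenbasis of \<open>A\<close>, \<open>L\<close> is integration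
  against a measure of mass at most \<open>c\<close> on the nonnegative half-line, so Chebyshev's inequality gives
  \<open>L f * L g \<le> c * L (f g)\<close> for increasing nonnegative \<open>f\<close> and \<open>g\<close>. Expanding powers of \<open>D\<close> one factor
  at a time, each new factor \<open>v v\<^sup>T\<close> splits a product into two such integrals, and the inequality
  merges them again. The outcome is
  \<open>tr D\<^sup>q \<le> tr A\<^sup>q + L ((x + c)\<^sup>q - x\<^sup>q) / c\<close>, and summation against \<open>1 / q!\<close> yields
  \<open>tr exp D \<le> tr exp A + (exp c - 1) / c * v\<^sup>T exp(A) v\<close>.

  Truncating the exponential series keeps every matrix entry a polynomial in the entries of the
  vectors; expectations then factor by independence without exchanging them with a series, and the
  truncation is removed only in the final numerical inequality. The numerical constants of the
  sample size are met with \<open>c = ln 2\<close>, for which \<open>exp c - 1 = 1\<close>.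
\<close>

section \<open>Orthonormal eigenbases of symmetric matrices\<close>

lemma symmetric_matrix_inner:
  fixes A :: "real ^ 'n ^ 'n"
  assumes "transpose A = A"
  shows "x \<bullet> (A *v y) = (A *v x) \<bullet> y"
  by (metis assms dot_lmul_matrix transpose_matrix_vector)

text \<open>
  A maximiser of the Rayleigh quotient over the unit sphere of the subspace is an eigenvector.
\<close>

lemma symmetric_eigenvector_in_invariant_subspace:
  fixes A :: "real ^ 'n ^ 'n"
  assumes sym: "transpose A = A" and S: "subspace S"
    and inv: "\<And>x. x \<in> S \<Longrightarrow> A *v x \<in> S" and nz: "z \<in> S" "z \<noteq> 0"
  obtains x l where "x \<in> S" "norm x = 1" "A *v x = l *\<^sub>R x"
proof -
  let ?K = "S \<inter> sphere 0 1"
  have "compact ?K"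
    using closed_subspace[OF S] by (intro closed_Int_compact) auto
  moreover have "(1 / norm z) *\<^sub>R z \<in> ?K"
    using nz S by (auto simp: subspace_scale)
  moreover have "continuous_on ?K (\<lambda>x. x \<bullet> (A *v x))"
    by (intro continuous_intros matrix_vector_mult_linear_continuous_on)
  ultimately obtain x where x: "x \<in> ?K" and max: "\<And>y. y \<in> ?K \<Longrightarrow> y \<bullet> (A *v y) \<le> x \<bullet> (A *v x)"
    using continuous_attains_sup[of ?K "\<lambda>x. x \<bullet> (A *v x)"] by blast
  define l where "l = x \<bullet> (A *v x)"
  define B where "B y = l *\<^sub>R y - A *v y" for y
  have xx: "x \<bullet> x = 1" using x by (simp add: dot_square_norm)
  have pos: "0 \<le> y \<bullet> B y" if "y \<in> S" for y
  proof (cases "y = 0")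
    case False
    have "(1 / norm y) *\<^sub>R y \<in> ?K" using that False S by (auto simp: subspace_scale)
    from max[OF this] have "y \<bullet> (A *v y) / (norm y)\<^sup>2 \<le> l"
      by (simp add: l_def matrix_vector_mult_scaleR power2_eq_square)
    then have "y \<bullet> (A *v y) \<le> l * (norm y)\<^sup>2" using False by (simp add: divide_simps)
    then show ?thesis by (simp add: B_def inner_diff_right dot_square_norm)
  qed (simp add: B_def)
  have Bx: "x \<bullet> B x = 0" by (simp add: B_def inner_diff_right xx l_def)
  define y where "y = B x"
  have yS: "y \<in> S" using x inv S by (simp add: y_def B_def subspace_diff subspace_scale)
  have Badd: "B (x + t *\<^sub>R y) = B x + t *\<^sub>R B y" for t
    by (simp add: B_def algebra_simps matrix_vector_mult_scaleR)
  have sw: "x \<bullet> B y = y \<bullet> B x"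
    using symmetric_matrix_inner[OF sym, of x y]
    by (simp add: B_def inner_diff_right inner_commute)
  \<comment> \<open>The form \<open>B\<close> is nonnegative on \<open>S\<close> and vanishes at \<open>x\<close>, so \<open>B x\<close> is orthogonal to
    every direction of \<open>S\<close>, in particular to itself.\<close>
  have quad: "0 \<le> 2 * t * (y \<bullet> y) + t\<^sup>2 * (y \<bullet> B y)" for t
  proof -
    have "x + t *\<^sub>R y \<in> S" using x yS S by (simp add: subspace_add subspace_scale)
    from pos[OF this] show ?thesis
      unfolding Badd using Bx sw
      by (simp add: inner_add_left inner_add_right power2_eq_square algebra_simps flip: y_def)
  qed
  have "y \<bullet> y = 0"
  proof (rule ccontr)
    assume "y \<bullet> y \<noteq> 0"
    then have yy: "0 < y \<bullet> y" by (simp add: inner_gt_zero_iff)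
    define q where "q = y \<bullet> B y"
    have q: "0 \<le> q" using pos[OF yS] by (simp add: q_def)
    define t where "t = (y \<bullet> y) / (q + 1)"
    have t: "0 < t" "t * q = y \<bullet> y - t" using yy q by (simp_all add: t_def field_simps)
    have "t\<^sup>2 * q = t * (t * q)" by (simp add: power2_eq_square)
    also have "\<dots> = t * (y \<bullet> y) - t * t" unfolding t(2) by (simp add: right_diff_distrib)
    finally have "0 \<le> - (t * (y \<bullet> y)) - t * t" using quad[of "- t"] by (simp add: q_def)
    moreover have "0 < t * (y \<bullet> y)" "0 < t * t" using t yy by simp_all
    ultimately show False by linarith
  qed
  then have "A *v x = l *\<^sub>R x" by (simp add: y_def B_def)
  then show ?thesis using that x by auto
qed

definition eigenbasis :: "real ^ 'n ^ 'n \<Rightarrow> ('n \<Rightarrow> real ^ 'n) \<Rightarrow> ('n \<Rightarrow> real) \<Rightarrow> bool" where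
  "eigenbasis A e l \<longleftrightarrow>
     (\<forall>i j. e i \<bullet> e j = (if i = j then 1 else 0)) \<and> (\<forall>i. A *v e i = l i *\<^sub>R e i)"

text \<open>
  An orthonormal set of eigenvectors of maximal cardinality spans the space: otherwise its
  orthogonal complement, which is invariant under a symmetric matrix, contains a further eigenvector.
\<close>

theorem symmetric_eigenbasis:
  fixes A :: "real ^ 'n ^ 'n"
  assumes sym: "transpose A = A"
  obtains e l where "eigenbasis A e l"
proof -
  define P where "P B \<longleftrightarrow> pairwise orthogonal B \<and> (\<forall>x\<in>B. norm x = 1 \<and> (\<exists>l. A *v x = l *\<^sub>R x))"
    for B :: "(real ^ 'n) set"
  have indep: "independent B" if "P B" for B
    using that pairwise_orthogonal_independent[of B] by (force simp: P_def)
  have "P {}" by (simp add: P_def pairwise_def)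
  moreover have "\<forall>B. P B \<longrightarrow> card B < Suc CARD('n)"
    using indep independent_bound by (force simp: less_Suc_eq_le)
  ultimately obtain B where B: "P B" and Bmax: "\<And>C. P C \<Longrightarrow> card C \<le> card B"
    using ex_has_greatest_nat[of P "{}" card "Suc CARD('n)"] by (metis less_imp_le)
  have fin: "finite B" using indep[OF B] independent_bound by blast
  have "span B = UNIV"
  proof (rule ccontr)
    assume "span B \<noteq> UNIV"
    then obtain z where z: "z \<noteq> 0" "\<And>x. x \<in> span B \<Longrightarrow> orthogonal z x"
      by (metis orthogonal_to_subspace_exists_gen psubsetI span_UNIV subset_UNIV)
    define S where "S = {x. \<forall>b\<in>B. orthogonal b x}"
    have S: "subspace S"
      by (auto simp: S_def subspace_def orthogonal_def inner_add_right)
    have inv: "A *v x \<in> S" if "x \<in> S" for x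
      using that B symmetric_matrix_inner[OF sym] by (fastforce simp: S_def P_def orthogonal_def)
    have "z \<in> S" using z by (auto simp: S_def orthogonal_commute span_base)
    then obtain x l where x: "x \<in> S" "norm x = 1" "A *v x = l *\<^sub>R x"
      using symmetric_eigenvector_in_invariant_subspace[OF sym S inv] z(1) by metis
    have "P (insert x B)"
      using x B by (auto simp: P_def S_def pairwise_insert orthogonal_commute)
    moreover have "x \<notin> B" using x by (auto simp: S_def orthogonal_self)
    ultimately show False using Bmax[of "insert x B"] fin by simp
  qed
  then have "card B = CARD('n)"
    using indep[OF B] by (metis dim_UNIV dim_eq_card_independent dim_span DIM_cart DIM_real mult.right_neutral)
  then obtain e where e: "bij_betw e (UNIV :: 'n set) B"
    using finite_same_card_bij[of "UNIV :: 'n set" B] fin by auto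
  have eB: "e i \<in> B" for i using e by (auto simp: bij_betw_def)
  have "e i \<bullet> e j = (if i = j then 1 else 0)" for i j
  proof (cases "i = j")
    case True then show ?thesis using B eB by (simp add: P_def dot_square_norm)
  next
    case False
    then have "e i \<noteq> e j" using e by (auto simp: bij_betw_def inj_on_def)
    then show ?thesis using B eB False by (simp add: P_def pairwise_def orthogonal_def)
  qed
  moreover have "\<exists>l. \<forall>i. A *v e i = l i *\<^sub>R e i"
    using B eB by (intro choice) (auto simp: P_def)
  ultimately show ?thesis using that by (auto simp: eigenbasis_def)
qed

text \<open>
  The matrix with rows \<open>e k\<close> has orthonormal rows; being square, it also preserves inner products.
\<close>

lemma eigenbasis_parseval:
  assumes "eigenbasis A e l"
  shows "(\<Sum>k\<in>UNIV. (x \<bullet> e k) * (y \<bullet> e k)) = x \<bullet> y"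
proof -
  define Q where "Q = (\<chi> k. e k)"
  have "Q ** transpose Q = mat 1"
    using assms by (simp add: vec_eq_iff matrix_matrix_mult_def transpose_def mat_def Q_def
      eigenbasis_def inner_vec_def)
  then have "transpose Q ** Q = mat 1" by (simp add: matrix_left_right_inverse)
  then have "x \<bullet> y = x \<bullet> (transpose Q *v (Q *v y))"
    by (simp add: matrix_vector_mul_assoc)
  also have "\<dots> = (Q *v x) \<bullet> (Q *v y)"
    by (metis dot_lmul_matrix vector_transpose_matrix)
  finally show ?thesis
    by (subst (asm) (2) inner_vec_def) (simp add: matrix_vector_mul_component Q_def inner_commute)
qed

lemma eigenbasis_coeff:
  assumes "eigenbasis A e l" "transpose A = A"
  shows "(A *v x) \<bullet> e k = l k * (x \<bullet> e k)"
  using assms symmetric_matrix_inner[of A x "e k"] by (simp add: eigenbasis_def)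

text \<open>
  Every matrix \<open>B\<close> is allowed, not only a function of \<open>A\<close>: the trace is independent of the
  orthonormal basis.
\<close>

lemma eigenbasis_trace:
  assumes "eigenbasis A e l"
  shows "trace B = (\<Sum>k\<in>UNIV. e k \<bullet> (B *v e k))"
proof -
  have d: "(\<Sum>k\<in>UNIV. e k $ a * e k $ b) = (if a = b then 1 else 0)" for a b
    using eigenbasis_parseval[OF assms, of "axis a 1" "axis b 1"]
    by (simp add: inner_axis' inner_axis) (simp add: axis_def)
  have "(\<Sum>k\<in>UNIV. e k \<bullet> (B *v e k)) = (\<Sum>k\<in>UNIV. \<Sum>a\<in>UNIV. \<Sum>b\<in>UNIV. B $ a $ b * (e k $ a * e k $ b))"
    by (simp add: inner_vec_def matrix_vector_mult_def sum_distrib_left mult_ac)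
  also have "\<dots> = (\<Sum>a\<in>UNIV. \<Sum>b\<in>UNIV. B $ a $ b * (\<Sum>k\<in>UNIV. e k $ a * e k $ b))"
    unfolding sum_distrib_left
    by (rule trans[OF sum.swap], rule sum.cong[OF refl], rule sum.swap)
  also have "\<dots> = trace B" by (simp add: d trace_def if_distrib cong: if_cong)
  finally show ?thesis by simp
qed

primrec mpow :: "real ^ 'n ^ 'n \<Rightarrow> nat \<Rightarrow> real ^ 'n ^ 'n" where
  "mpow A 0 = mat 1"
| "mpow A (Suc q) = A ** mpow A q"

lemma mpow_Suc2: "mpow A (Suc q) = mpow A q ** A"
  by (induction q) (simp_all add: matrix_mul_assoc)

lemma transpose_mpow: "transpose A = A \<Longrightarrow> transpose (mpow A q) = mpow A q"
  by (induction q) (simp_all add: matrix_transpose_mul mpow_Suc2 del: mpow.simps(2), simp add: mpow_Suc2[symmetric])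

lemma mpow_eigenvector: "A *v x = l *\<^sub>R x \<Longrightarrow> mpow A q *v x = l ^ q *\<^sub>R x"
  by (induction q) (simp_all add: matrix_vector_mul_assoc[symmetric] matrix_vector_mult_scaleR mult.commute)

lemma eigenbasis_mpow:
  assumes "eigenbasis A e l"
  shows "eigenbasis (mpow A q) e (\<lambda>k. l k ^ q)"
  using assms by (simp add: eigenbasis_def mpow_eigenvector)

lemma eigenbasis_quadratic_form:
  assumes "eigenbasis A e l" "transpose A = A"
  shows "x \<bullet> (A *v x) = (\<Sum>k\<in>UNIV. l k * (x \<bullet> e k)\<^sup>2)"
  using eigenbasis_parseval[OF assms(1), of x "A *v x"]
  by (simp add: eigenbasis_coeff[OF assms] power2_eq_square mult_ac)

lemma eigenbasis_psd:
  assumes "eigenbasis A e l" "psd A"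
  shows "0 \<le> l k"
proof -
  have "0 \<le> e k \<bullet> (A *v e k)" using assms by (simp add: psd_def)
  then show ?thesis using assms by (simp add: eigenbasis_def)
qed

text \<open>
  The set whose maximum is taken is exactly the finite range of \<open>l\<close>, so the maximum
  exists and bounds every \<open>l k\<close>.
\<close>

lemma lambda_max_eigenbasis:
  assumes e: "eigenbasis A e l" and sym: "transpose A = A"
  shows "lambda_max A = Max (range l)"
proof -
  have "{t. \<exists>v. v \<noteq> 0 \<and> A *v v = t *\<^sub>R v} = range l"
  proof (intro equalityI subsetI)
    fix t assume "t \<in> {t. \<exists>v. v \<noteq> 0 \<and> A *v v = t *\<^sub>R v}"
    then obtain v where v: "v \<noteq> 0" "A *v v = t *\<^sub>R v" by blast
    have "\<exists>k. v \<bullet> e k \<noteq> 0"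
      using eigenbasis_parseval[OF e, of v v] v(1)
      by (metis (no_types, lifting) inner_eq_zero_iff mult_zero_left sum.neutral)
    then obtain k where "v \<bullet> e k \<noteq> 0" ..
    then have "t = l k" using eigenbasis_coeff[OF e sym, of v k] v(2) by simp
    then show "t \<in> range l" by simp
  next
    fix t assume "t \<in> range l"
    then obtain k where k: "t = l k" by blast
    have "e k \<bullet> e k = 1" using e by (simp add: eigenbasis_def)
    then have "e k \<noteq> 0" by auto
    then show "t \<in> {t. \<exists>v. v \<noteq> 0 \<and> A *v v = t *\<^sub>R v}"
      using e k by (auto simp: eigenbasis_def)
  qed
  then show ?thesis by (simp add: lambda_max_def)
qed

lemma quadratic_form_le_lambda_max:
  fixes A :: "real ^ 'n ^ 'n"
  assumes sym: "transpose A = A"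
  shows "x \<bullet> (A *v x) \<le> lambda_max A * (x \<bullet> x)"
proof -
  obtain e l where e: "eigenbasis A e l" using symmetric_eigenbasis[OF sym] .
  have "x \<bullet> (A *v x) = (\<Sum>k\<in>UNIV. l k * (x \<bullet> e k)\<^sup>2)"
    by (rule eigenbasis_quadratic_form[OF e sym])
  also have "\<dots> \<le> (\<Sum>k\<in>UNIV. lambda_max A * (x \<bullet> e k)\<^sup>2)"
    by (intro sum_mono mult_right_mono) (auto simp: lambda_max_eigenbasis[OF e sym])
  also have "\<dots> = lambda_max A * (x \<bullet> x)"
    using eigenbasis_parseval[OF e, of x x] by (simp add: power2_eq_square flip: sum_distrib_left)
  finally show ?thesis .
qed

lemma lambda_max_nonneg:
  assumes "psd A"
  shows "0 \<le> lambda_max A"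
proof -
  have sym: "transpose A = A" using assms by (simp add: psd_def)
  obtain e l where e: "eigenbasis A e l" using symmetric_eigenbasis[OF sym] .
  have "0 \<le> l undefined" using eigenbasis_psd[OF e assms] .
  also have "\<dots> \<le> lambda_max A" by (simp add: lambda_max_eigenbasis[OF e sym])
  finally show ?thesis .
qed

section \<open>Traces of powers after a rank-one update\<close>

lemma outer_mult_vec: "outer a b *v x = (b \<bullet> x) *\<^sub>R a"
  by (simp add: vec_eq_iff outer_def matrix_vector_mult_def inner_vec_def sum_distrib_left mult_ac)

lemma matrix_mult_add_rdistrib: "(A + B) ** C = A ** C + B ** (C :: real ^ 'n ^ 'n)"
  by (simp add: vec_eq_iff matrix_matrix_mult_def distrib_right sum.distrib)

lemma trace_outer_mult: "trace (P ** outer v v ** Q) = v \<bullet> (Q ** P *v v)"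
proof -
  have "trace (P ** outer v v ** Q) = trace ((Q ** P) ** outer v v)"
    by (metis trace_mul_sym matrix_mul_assoc)
  also have "\<dots> = v \<bullet> (Q ** P *v v)"
    by (simp add: trace_def outer_def matrix_matrix_mult_def inner_vec_def matrix_vector_mult_def
      sum_distrib_left mult_ac)
  finally show ?thesis .
qed

text \<open>
  Expanding the double sum of \<open>w i * w j * (f i - f j) * (g i - g j)\<close>, whose terms are nonnegative
  for similarly ordered \<open>f\<close> and \<open>g\<close>, gives twice the difference of the two sides.
\<close>

lemma chebyshev_sum:
  fixes f g w :: "'a \<Rightarrow> real"
  assumes "finite S" and w: "\<And>i. i \<in> S \<Longrightarrow> 0 \<le> w i"
    and mono: "\<And>i j. i \<in> S \<Longrightarrow> j \<in> S \<Longrightarrow> 0 \<le> (f i - f j) * (g i - g j)"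
  shows "(\<Sum>i\<in>S. w i * f i) * (\<Sum>i\<in>S. w i * g i) \<le> (\<Sum>i\<in>S. w i) * (\<Sum>i\<in>S. w i * (f i * g i))"
proof -
  have "0 \<le> (\<Sum>i\<in>S. \<Sum>j\<in>S. w i * w j * ((f i - f j) * (g i - g j)))"
    by (intro sum_nonneg mult_nonneg_nonneg[OF mult_nonneg_nonneg] w mono)
  also have "\<dots> = (\<Sum>i\<in>S. \<Sum>j\<in>S. w i * (w j * (f j * g j))) + (\<Sum>i\<in>S. \<Sum>j\<in>S. w i * (f i * g i) * w j)
      - (\<Sum>i\<in>S. \<Sum>j\<in>S. w i * f i * (w j * g j)) - (\<Sum>i\<in>S. \<Sum>j\<in>S. w i * g i * (w j * f j))"
    unfolding sum.distrib[symmetric] sum_subtractf[symmetric]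
    by (intro sum.cong refl) (simp add: algebra_simps)
  also have "\<dots> = 2 * ((\<Sum>i\<in>S. w i) * (\<Sum>i\<in>S. w i * (f i * g i)))
      - 2 * ((\<Sum>i\<in>S. w i * f i) * (\<Sum>i\<in>S. w i * g i))"
    unfolding sum_product[symmetric] by simp
  finally show ?thesis by simp
qed

text \<open>
  The situation of adding \<open>v v\<^sup>T\<close> to a diagonalised positive semidefinite matrix. The upper bound
  \<open>c\<close> replaces the exact value of \<open>v \<bullet> v\<close>, so that the same \<open>c\<close> can serve all increments of a sum.
\<close>

locale rank_one_update =
  fixes A :: "real ^ 'n ^ 'n" and e :: "'n \<Rightarrow> real ^ 'n" and l :: "'n \<Rightarrow> real"
    and v :: "real ^ 'n" and c :: real
  assumes basis: "eigenbasis A e l" and psd: "psd A" and v: "v \<bullet> v \<le> c" and c: "0 < c"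
begin

lemma sym: "transpose A = A"
  using psd by (simp add: psd_def)

lemma nonneg: "0 \<le> l k"
  using eigenbasis_psd[OF basis psd] .

text \<open>
  The spectral measure of \<open>A\<close> at \<open>v\<close>, as an integral: \<open>L f\<close> is \<open>v \<bullet> (f(A) *v v)\<close>.
\<close>

definition L :: "(real \<Rightarrow> real) \<Rightarrow> real" where
  "L f = (\<Sum>k\<in>UNIV. (v \<bullet> e k)\<^sup>2 * f (l k))"

lemma L_mpow: "v \<bullet> (mpow A a *v v) = L (\<lambda>x. x ^ a)"
  using eigenbasis_quadratic_form[OF eigenbasis_mpow[OF basis] transpose_mpow[OF sym]]
  by (simp add: L_def mult.commute)

lemma L_mono: "(\<And>x. 0 \<le> x \<Longrightarrow> f x \<le> g x) \<Longrightarrow> L f \<le> L g"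
  unfolding L_def by (intro sum_mono mult_left_mono) (auto simp: nonneg)

text \<open>
  Chebyshev's inequality for the spectral measure, whose total mass is \<open>v \<bullet> v\<close>.
\<close>

lemma L_mult:
  assumes "\<And>x y. 0 \<le> x \<Longrightarrow> x \<le> y \<Longrightarrow> f x \<le> f y" "\<And>x y. 0 \<le> x \<Longrightarrow> x \<le> y \<Longrightarrow> g x \<le> g y"
    and "\<And>x. 0 \<le> x \<Longrightarrow> 0 \<le> f x * g x"
  shows "L f * L g \<le> c * L (\<lambda>x. f x * g x)"
proof -
  have "0 \<le> (f (l i) - f (l j)) * (g (l i) - g (l j))" for i j
  proof (cases "l i \<le> l j")
    case True
    then show ?thesis using assms(1,2)[OF nonneg True] by (intro mult_nonpos_nonpos) auto
  next
    case False
    then have "l j \<le> l i" by simp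
    then show ?thesis using assms(1,2)[OF nonneg \<open>l j \<le> l i\<close>] by (intro mult_nonneg_nonneg) auto
  qed
  then have "L f * L g \<le> (\<Sum>k\<in>UNIV. (v \<bullet> e k)\<^sup>2) * L (\<lambda>x. f x * g x)"
    unfolding L_def by (intro chebyshev_sum) auto
  also have "(\<Sum>k\<in>UNIV. (v \<bullet> e k)\<^sup>2) = v \<bullet> v"
    using eigenbasis_parseval[OF basis, of v v] by (simp add: power2_eq_square)
  also have "(v \<bullet> v) * L (\<lambda>x. f x * g x) \<le> c * L (\<lambda>x. f x * g x)"
    unfolding L_def by (intro mult_right_mono v sum_nonneg mult_nonneg_nonneg assms(3) nonneg zero_le_power2)
  finally show ?thesis .
qed

abbreviation "D \<equiv> A + outer v v"

text \<open>
  In these forms the increment \<open>v v\<^sup>T\<close> acts at most like the scalar \<open>c\<close>. Splitting the first factor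
  \<open>D\<close> gives the form with a further \<open>A\<close> plus a product of two forms, which Chebyshev's inequality
  merges. The bound must be stated for all \<open>a\<close> at once, as the first summand raises \<open>a\<close>, while
  the second uses the case \<open>a = 0\<close>.
\<close>

lemma mixed_moment_le: "v \<bullet> (mpow A a ** mpow D q *v v) \<le> L (\<lambda>x. x ^ a * (x + c) ^ q)"
proof (induction q arbitrary: a)
  case 0
  show ?case by (simp add: L_mpow)
next
  case (Suc q)
  have nonnegL: "0 \<le> L (\<lambda>x. x ^ a)"
    unfolding L_def by (intro sum_nonneg) (simp add: nonneg)
  have "mpow A a ** mpow D (Suc q) = mpow A (Suc a) ** mpow D q + mpow A a ** outer v v ** mpow D q"
    unfolding mpow_Suc2[of A] mpow.simps(2)[of D]
    by (simp add: matrix_mul_assoc matrix_add_ldistrib matrix_mult_add_rdistrib)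
  then have "v \<bullet> (mpow A a ** mpow D (Suc q) *v v)
      = v \<bullet> (mpow A (Suc a) ** mpow D q *v v) + v \<bullet> (mpow A a *v v) * (v \<bullet> (mpow D q *v v))"
    by (simp only: matrix_vector_mult_add_rdistrib inner_add_right outer_mult_vec
      matrix_vector_mult_scaleR inner_scaleR_right mult.commute flip: matrix_vector_mul_assoc)
  also have "\<dots> \<le> L (\<lambda>x. x ^ Suc a * (x + c) ^ q) + L (\<lambda>x. x ^ a) * L (\<lambda>x. (x + c) ^ q)"
    using Suc.IH[of "Suc a"] Suc.IH[of 0] nonnegL unfolding L_mpow
    by (intro add_mono mult_left_mono) auto
  also have "\<dots> \<le> L (\<lambda>x. x ^ Suc a * (x + c) ^ q) + c * L (\<lambda>x. x ^ a * (x + c) ^ q)"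
    using c by (intro add_left_mono L_mult power_mono) auto
  also have "\<dots> = L (\<lambda>x. x ^ a * (x + c) ^ Suc q)"
    unfolding L_def sum_distrib_left sum.distrib[symmetric]
    by (intro sum.cong refl) (simp add: algebra_simps)
  finally show ?case .
qed

text \<open>
  The factors \<open>D\<close> are replaced by \<open>A\<close> one by one. Each replacement costs one form
  \<open>v \<bullet> (mpow A a ** mpow D q *v v)\<close>, bounded above, and these costs telescope because
  \<open>c = (x + c) - x\<close>.
\<close>

lemma trace_mixed_moment_le:
  "trace (mpow D q ** mpow A a) \<le> trace (mpow A (a + q)) + L (\<lambda>x. x ^ a * ((x + c) ^ q - x ^ q)) / c"
proof (induction q arbitrary: a)
  case 0
  show ?case by (simp add: L_def)
next
  case (Suc q)
  have "mpow D (Suc q) ** mpow A a = mpow D q ** mpow A (Suc a) + mpow D q ** outer v v ** mpow A a"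
    unfolding mpow_Suc2[of D] by (simp add: matrix_mul_assoc matrix_add_ldistrib matrix_mult_add_rdistrib)
  then have "trace (mpow D (Suc q) ** mpow A a)
      = trace (mpow D q ** mpow A (Suc a)) + v \<bullet> (mpow A a ** mpow D q *v v)"
    by (simp only: trace_add trace_outer_mult)
  also have "\<dots> \<le> trace (mpow A (Suc a + q)) + L (\<lambda>x. x ^ Suc a * ((x + c) ^ q - x ^ q)) / c
      + L (\<lambda>x. x ^ a * (x + c) ^ q)"
    using Suc.IH[of "Suc a"] mixed_moment_le[of a q] by linarith
  also have "\<dots> = trace (mpow A (a + Suc q)) + L (\<lambda>x. x ^ a * ((x + c) ^ Suc q - x ^ Suc q)) / c"
  proof -
    have "L (\<lambda>x. x ^ Suc a * ((x + c) ^ q - x ^ q)) + c * L (\<lambda>x. x ^ a * (x + c) ^ q)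
        = L (\<lambda>x. x ^ a * ((x + c) ^ Suc q - x ^ Suc q))"
      unfolding L_def sum_distrib_left sum.distrib[symmetric]
      by (intro sum.cong refl) (simp add: algebra_simps)
    then show ?thesis using c by (simp add: field_simps del: power_Suc)
  qed
  finally show ?case .
qed

end

section \<open>Truncated matrix exponentials\<close>

definition exp_trunc :: "nat \<Rightarrow> real \<Rightarrow> real" where
  "exp_trunc Q x = (\<Sum>q\<le>Q. x ^ q / fact q)"

definition mexp_trunc :: "nat \<Rightarrow> real ^ 'n ^ 'n \<Rightarrow> real ^ 'n ^ 'n" where
  "mexp_trunc Q A = (\<Sum>q\<le>Q. (1 / fact q) *\<^sub>R mpow A q)"

lemma exp_trunc_0: "exp_trunc Q 0 = 1"
  unfolding exp_trunc_def by (induction Q) simp_all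

lemma exp_trunc_limit: "(\<lambda>Q. exp_trunc Q x) \<longlonglongrightarrow> exp x"
proof -
  have "(\<lambda>q. x ^ q / fact q) sums exp x"
    using exp_converges[of x] by (simp add: divide_inverse mult.commute)
  then show ?thesis by (simp add: exp_trunc_def sums_def_le)
qed

lemma exp_trunc_le_exp: "0 \<le> x \<Longrightarrow> exp_trunc Q x \<le> exp x"
  by (rule incseq_le[OF _ exp_trunc_limit]) (auto intro!: monoI sum_mono2 simp: exp_trunc_def)

lemma exp_trunc_mono: "0 \<le> x \<Longrightarrow> x \<le> y \<Longrightarrow> exp_trunc Q x \<le> exp_trunc Q y"
  unfolding exp_trunc_def by (intro sum_mono divide_right_mono power_mono) auto

lemma exp_trunc_nonneg: "0 \<le> x \<Longrightarrow> 0 \<le> exp_trunc Q x"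
  unfolding exp_trunc_def by (intro sum_nonneg) auto

text \<open>
  The Cauchy product of the two truncated series covers the triangle \<open>i + j \<le> Q\<close> of the square of
  all products of their terms.
\<close>

lemma exp_trunc_add_le:
  assumes "0 \<le> x" "0 \<le> y"
  shows "exp_trunc Q (x + y) \<le> exp_trunc Q x * exp y"
proof -
  have "(x + y) ^ q / fact q = (\<Sum>i\<le>q. x ^ i / fact i * (y ^ (q - i) / fact (q - i)))" for q
    using exp_series_add_commuting[of x y q] by (simp add: divide_inverse mult_ac)
  then have "exp_trunc Q (x + y) = (\<Sum>(i, j)\<in>{(i, j). i + j \<le> Q}. x ^ i / fact i * (y ^ j / fact j))"
    unfolding exp_trunc_def by (simp only: sum.triangle_reindex_eq)
  also have "\<dots> \<le> (\<Sum>(i, j)\<in>{..Q} \<times> {..Q}. x ^ i / fact i * (y ^ j / fact j))"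
    using assms by (intro sum_mono2) auto
  also have "\<dots> = exp_trunc Q x * exp_trunc Q y"
    by (simp add: exp_trunc_def sum_product sum.cartesian_product)
  also have "\<dots> \<le> exp_trunc Q x * exp y"
    using assms by (intro mult_left_mono exp_trunc_le_exp exp_trunc_nonneg)
  finally show ?thesis .
qed

lemma sum_matrix_vector_mult: "(\<Sum>i\<in>S. B i) *v x = (\<Sum>i\<in>S. B i *v (x :: real ^ 'n))"
  by (induction S rule: infinite_finite_induct) (simp_all add: matrix_vector_mult_add_rdistrib)

lemma trace_sum: "trace (\<Sum>i\<in>S. B i) = (\<Sum>i\<in>S. trace (B i :: real ^ 'n ^ 'n))"
  by (induction S rule: infinite_finite_induct) (simp_all add: trace_0[unfolded mat_0] trace_add)

lemma trace_scaleR: "trace (t *\<^sub>R B) = t * trace (B :: real ^ 'n ^ 'n)"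
  by (simp add: trace_def sum_distrib_left)

lemma eigenbasis_mexp_trunc:
  assumes "eigenbasis A e l"
  shows "eigenbasis (mexp_trunc Q A) e (\<lambda>k. exp_trunc Q (l k))"
proof -
  have "mexp_trunc Q A *v e k = exp_trunc Q (l k) *\<^sub>R e k" for k
  proof -
    have "A *v e k = l k *\<^sub>R e k" using assms by (simp add: eigenbasis_def)
    from mpow_eigenvector[OF this] show ?thesis
      by (simp add: mexp_trunc_def exp_trunc_def sum_matrix_vector_mult scaleR_sum_left
        flip: scaleR_matrix_vector_assoc)
  qed
  then show ?thesis using assms by (simp add: eigenbasis_def)
qed

lemma transpose_mexp_trunc:
  fixes A :: "real ^ 'n ^ 'n"
  assumes "transpose A = A"
  shows "transpose (mexp_trunc Q A) = mexp_trunc Q A"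
proof -
  have "mpow A q $ i $ j = mpow A q $ j $ i" for q i j
    using transpose_mpow[OF assms, of q] by (metis (no_types) transpose_def vec_lambda_beta)
  then show ?thesis by (simp add: vec_eq_iff transpose_def mexp_trunc_def)
qed

lemma trace_mexp_trunc:
  assumes "eigenbasis A e l"
  shows "trace (mexp_trunc Q A) = (\<Sum>k\<in>UNIV. exp_trunc Q (l k))"
  using eigenbasis_trace[OF assms, of "mexp_trunc Q A"] eigenbasis_mexp_trunc[OF assms, of Q]
  by (simp add: eigenbasis_def)

lemma trace_mexp_trunc_nonneg:
  assumes "psd A"
  shows "0 \<le> trace (mexp_trunc Q A)"
proof -
  obtain e l where el: "eigenbasis A e l"
    using symmetric_eigenbasis assms unfolding psd_def by metis
  show ?thesis
    unfolding trace_mexp_trunc[OF el]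
    by (intro sum_nonneg exp_trunc_nonneg eigenbasis_psd[OF el assms])
qed

text \<open>
  The substitute for the Golden-Thompson inequality. The bounds on traces of powers add up to a
  bound by \<open>exp_trunc Q (x + c) - exp_trunc Q x\<close>, and shifting the argument by \<open>c\<close> costs at most the
  factor \<open>exp c\<close>.
\<close>

lemma trace_mexp_trunc_rank_one_le:
  fixes A :: "real ^ 'n ^ 'n"
  assumes "psd A" "v \<bullet> v \<le> c" "0 < c"
  shows "trace (mexp_trunc Q (A + outer v v))
    \<le> trace (mexp_trunc Q A) + (exp c - 1) / c * (v \<bullet> (mexp_trunc Q A *v v))"
proof -
  have sym: "transpose A = A" using assms by (simp add: psd_def)
  obtain e l where el: "eigenbasis A e l" using symmetric_eigenbasis[OF sym] .
  interpret rank_one_update A e l v c using el assms by unfold_locales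
  have "trace (mexp_trunc Q D) = (\<Sum>q\<le>Q. 1 / fact q * trace (mpow D q))"
    by (simp add: mexp_trunc_def trace_sum trace_scaleR)
  also have "\<dots> \<le> (\<Sum>q\<le>Q. 1 / fact q * (trace (mpow A q) + L (\<lambda>x. (x + c) ^ q - x ^ q) / c))"
    using trace_mixed_moment_le[of _ 0] by (intro sum_mono mult_left_mono) auto
  also have "\<dots> = trace (mexp_trunc Q A) + L (\<lambda>x. exp_trunc Q (x + c) - exp_trunc Q x) / c"
  proof -
    have "L (\<lambda>x. exp_trunc Q (x + c) - exp_trunc Q x)
        = (\<Sum>k\<in>UNIV. \<Sum>q\<le>Q. (v \<bullet> e k)\<^sup>2 * (1 / fact q * ((l k + c) ^ q - l k ^ q)))"
      by (simp add: L_def exp_trunc_def sum_distrib_left diff_divide_distrib flip: sum_subtractf)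
    also have "\<dots> = (\<Sum>q\<le>Q. \<Sum>k\<in>UNIV. (v \<bullet> e k)\<^sup>2 * (1 / fact q * ((l k + c) ^ q - l k ^ q)))"
      by (rule sum.swap)
    also have "\<dots> = (\<Sum>q\<le>Q. 1 / fact q * L (\<lambda>x. (x + c) ^ q - x ^ q))"
      by (simp add: L_def sum_distrib_left mult_ac)
    finally show ?thesis
      by (simp add: mexp_trunc_def trace_sum trace_scaleR distrib_left sum.distrib sum_divide_distrib)
  qed
  also have "L (\<lambda>x. exp_trunc Q (x + c) - exp_trunc Q x) \<le> L (\<lambda>x. (exp c - 1) * exp_trunc Q x)"
    using assms(3) exp_trunc_add_le[of _ c Q] by (intro L_mono) (auto simp: algebra_simps)
  also have "\<dots> = (exp c - 1) * (v \<bullet> (mexp_trunc Q A *v v))"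
    using eigenbasis_quadratic_form[OF eigenbasis_mexp_trunc[OF el] transpose_mexp_trunc[OF sym], of v Q]
    by (simp add: L_def sum_distrib_left mult_ac)
  finally show ?thesis using assms(3) by (simp add: divide_right_mono)
qed

text \<open>
  In an eigenbasis of \<open>A\<close> the trace on the left is a combination of the values of the quadratic form
  of \<open>B\<close> on unit vectors, with nonnegative coefficients whose sum is the trace on the right.
\<close>

lemma trace_mexp_trunc_mult_le:
  fixes A B :: "real ^ 'n ^ 'n"
  assumes A: "psd A" and B: "\<And>x. x \<bullet> (B *v x) \<le> b * (x \<bullet> x)"
  shows "trace (mexp_trunc Q A ** B) \<le> b * trace (mexp_trunc Q A)"
proof -
  have sym: "transpose A = A" using A by (simp add: psd_def)
  obtain e l where el: "eigenbasis A e l" using symmetric_eigenbasis[OF sym] .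
  have E: "e k \<bullet> ((mexp_trunc Q A ** B) *v e k) = exp_trunc Q (l k) * (e k \<bullet> (B *v e k))" for k
  proof -
    have "e k \<bullet> ((mexp_trunc Q A ** B) *v e k) = (mexp_trunc Q A *v e k) \<bullet> (B *v e k)"
      unfolding matrix_vector_mul_assoc[symmetric]
      by (rule symmetric_matrix_inner[OF transpose_mexp_trunc[OF sym]])
    then show ?thesis using eigenbasis_mexp_trunc[OF el, of Q] by (simp add: eigenbasis_def)
  qed
  have "trace (mexp_trunc Q A ** B) = (\<Sum>k\<in>UNIV. exp_trunc Q (l k) * (e k \<bullet> (B *v e k)))"
    unfolding eigenbasis_trace[OF el] E ..
  also have "\<dots> \<le> (\<Sum>k\<in>UNIV. exp_trunc Q (l k) * b)"
  proof (intro sum_mono mult_left_mono)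
    fix k
    show "e k \<bullet> (B *v e k) \<le> b" using B[of "e k"] el by (simp add: eigenbasis_def)
    show "0 \<le> exp_trunc Q (l k)" using eigenbasis_psd[OF el A] by (rule exp_trunc_nonneg)
  qed
  also have "\<dots> = b * trace (mexp_trunc Q A)"
    unfolding trace_mexp_trunc[OF el] by (simp add: sum_distrib_left mult.commute)
  finally show ?thesis .
qed

text \<open>
  The hypothesis on \<open>x\<close> forces an eigenvalue above \<open>b\<close>, and the truncated exponential of this
  eigenvalue is one of the nonnegative terms of the trace.
\<close>

lemma trace_mexp_trunc_ge:
  fixes A :: "real ^ 'n ^ 'n"
  assumes A: "psd A" and b: "0 \<le> b" and x: "b * (x \<bullet> x) < x \<bullet> (A *v x)"
  shows "exp_trunc Q b \<le> trace (mexp_trunc Q A)"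
proof -
  have sym: "transpose A = A" using A by (simp add: psd_def)
  obtain e l where el: "eigenbasis A e l" using symmetric_eigenbasis[OF sym] .
  have "\<exists>k. b < l k"
  proof (rule ccontr)
    assume "\<not> ?thesis"
    then have "(\<Sum>k\<in>UNIV. l k * (x \<bullet> e k)\<^sup>2) \<le> (\<Sum>k\<in>UNIV. b * (x \<bullet> e k)\<^sup>2)"
      by (intro sum_mono mult_right_mono) (auto simp: not_less)
    also have "\<dots> = b * (x \<bullet> x)"
      using eigenbasis_parseval[OF el, of x x] by (simp add: power2_eq_square flip: sum_distrib_left)
    finally show False using x eigenbasis_quadratic_form[OF el sym, of x] by simp
  qed
  then obtain k where "b < l k" ..
  then have "exp_trunc Q b \<le> exp_trunc Q (l k)" using b by (intro exp_trunc_mono) auto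
  also have "\<dots> \<le> (\<Sum>k\<in>UNIV. exp_trunc Q (l k))"
    using eigenbasis_psd[OF el A] by (intro member_le_sum) (auto intro: exp_trunc_nonneg)
  finally show ?thesis by (simp add: trace_mexp_trunc[OF el])
qed

section \<open>A Chernoff bound for sums of independent rank-one matrices\<close>

text \<open>
  Entries of a truncated exponential are polynomials in the entries of the matrix, so they belong to
  every algebra of functions that contains those; it is used for measurable functions and for
  bounded random variables.
\<close>

lemma matrix_function_entries_closed:
  fixes A :: "'s \<Rightarrow> real ^ 'n ^ 'n"
  assumes const: "\<And>t. C (\<lambda>_. t)"
    and add: "\<And>f g. C f \<Longrightarrow> C g \<Longrightarrow> C (\<lambda>s. f s + g s)"
    and mult: "\<And>f g. C f \<Longrightarrow> C g \<Longrightarrow> C (\<lambda>s. f s * g s)"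
    and A: "\<And>a b. C (\<lambda>s. A s $ a $ b)"
  shows "C (\<lambda>s. mexp_trunc Q (A s) $ a $ b)"
proof -
  have sum: "C (\<lambda>s. \<Sum>i\<in>S. f i s)" if "\<And>i. C (f i)" for f and S :: "'n set"
    by (induction S rule: infinite_finite_induct) (auto intro: const add that)
  have sum_nat: "C (\<lambda>s. \<Sum>i\<in>S. f i s)" if "\<And>i. C (f i)" for f and S :: "nat set"
    by (induction S rule: infinite_finite_induct) (auto intro: const add that)
  have "C (\<lambda>s. mpow (A s) q $ a $ b)" for q a b
  proof (induction q arbitrary: a b)
    case 0
    show ?case by (simp add: mat_def const)
  next
    case (Suc q)
    show ?case by (simp add: matrix_matrix_mult_def) (intro sum mult A Suc.IH)
  qed
  then have "C (\<lambda>s. \<Sum>q\<le>Q. 1 / fact q * mpow (A s) q $ a $ b)"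
    by (intro sum_nat mult const)
  then show ?thesis by (simp add: mexp_trunc_def)
qed

lemma sum_outer_quadratic_form:
  "x \<bullet> ((\<Sum>i\<in>F. outer (v i) (v i)) *v x) = (\<Sum>i\<in>F. (v i \<bullet> x)\<^sup>2)"
  by (simp add: sum_matrix_vector_mult outer_mult_vec inner_sum_right power2_eq_square inner_commute)

lemma psd_sum_outer: "psd (\<Sum>i\<in>F. outer (v i) (v i))"
  unfolding psd_def sum_outer_quadratic_form
  by (auto intro: sum_nonneg simp: vec_eq_iff transpose_def outer_def mult.commute)

lemma borel_measurable_component:
  fixes f :: "'s \<Rightarrow> real ^ 'n"
  assumes "f \<in> borel_measurable N"
  shows "(\<lambda>s. f s $ a) \<in> borel_measurable N"
  by (rule borel_measurable_continuous_on[OF _ assms]) (intro continuous_intros)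

context prob_space
begin

definition bounded_rv :: "('a \<Rightarrow> real) \<Rightarrow> bool" where
  "bounded_rv f \<longleftrightarrow> f \<in> borel_measurable M \<and> (\<exists>K. \<forall>s\<in>space M. \<bar>f s\<bar> \<le> K)"

lemma bounded_rv_integrable: "bounded_rv f \<Longrightarrow> integrable M f"
  unfolding bounded_rv_def by (auto intro!: integrable_const_bound AE_I2)

lemma bounded_rv_const: "bounded_rv (\<lambda>_. t)"
  by (auto simp: bounded_rv_def)

lemma bounded_rv_add:
  assumes "bounded_rv f" "bounded_rv g"
  shows "bounded_rv (\<lambda>s. f s + g s)"
proof -
  obtain K L where "\<forall>s\<in>space M. \<bar>f s\<bar> \<le> K" "\<forall>s\<in>space M. \<bar>g s\<bar> \<le> L"
    using assms by (auto simp: bounded_rv_def)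
  then have "\<forall>s\<in>space M. \<bar>f s + g s\<bar> \<le> K + L" by fastforce
  then show ?thesis using assms by (auto simp: bounded_rv_def)
qed

lemma bounded_rv_mult:
  assumes "bounded_rv f" "bounded_rv g"
  shows "bounded_rv (\<lambda>s. f s * g s)"
proof -
  obtain K L where "\<forall>s\<in>space M. \<bar>f s\<bar> \<le> K" "\<forall>s\<in>space M. \<bar>g s\<bar> \<le> L"
    using assms by (auto simp: bounded_rv_def)
  then have "\<forall>s\<in>space M. \<bar>f s * g s\<bar> \<le> \<bar>K\<bar> * \<bar>L\<bar>"
    by (fastforce simp: abs_mult intro: mult_mono)
  then show ?thesis using assms by (auto simp: bounded_rv_def)
qed

lemma bounded_rv_sum: "(\<And>i. i \<in> S \<Longrightarrow> bounded_rv (f i)) \<Longrightarrow> bounded_rv (\<lambda>s. \<Sum>i\<in>S. f i s)"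
  by (induction S rule: infinite_finite_induct) (auto intro: bounded_rv_const bounded_rv_add)

lemma bounded_rv_component:
  assumes "random_variable borel V" "\<And>s. s \<in> space M \<Longrightarrow> V s \<bullet> V s \<le> c"
  shows "bounded_rv (\<lambda>s. V s $ a)"
proof -
  have "\<bar>V s $ a\<bar> \<le> sqrt c" if "s \<in> space M" for s
  proof -
    have "\<bar>V s $ a\<bar> \<le> norm (V s)" by (rule component_le_norm_cart)
    also have "\<dots> \<le> sqrt c" using assms(2)[OF that] by (simp add: norm_eq_sqrt_inner)
    finally show ?thesis .
  qed
  moreover have "(\<lambda>s. V s $ a) \<in> borel_measurable M"
    using assms(1) by (rule borel_measurable_component)
  ultimately show ?thesis by (auto simp: bounded_rv_def)
qed

lemma bounded_rv_sum_outer: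
  assumes "\<And>i a. i \<in> F \<Longrightarrow> bounded_rv (\<lambda>s. V i s $ a)"
  shows "bounded_rv (\<lambda>s. mexp_trunc Q (\<Sum>i\<in>F. outer (V i s) (V i s)) $ a $ b)"
  by (rule matrix_function_entries_closed[where C = bounded_rv, OF bounded_rv_const bounded_rv_add bounded_rv_mult])
    (auto simp: outer_def intro!: bounded_rv_sum bounded_rv_mult assms)

text \<open>
  The summands are added one at a time. The new summand is independent of the sum \<open>A\<close> of the
  others, so the cross term \<open>v \<bullet> (N *v v)\<close>, with \<open>N\<close> the truncated exponential of \<open>A\<close>, has the
  expectation of \<open>tr (N ** B)\<close> with \<open>B\<close> the second moment matrix of \<open>v\<close>, and this is at most
  \<open>b i * tr N\<close>. Thus each summand contributes the factor
  \<open>1 + (exp c - 1) / c * b i\<close>, which is at most the exponential of \<open>(exp c - 1) / c * b i\<close>.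
\<close>

theorem expectation_trace_mexp_trunc_le:
  fixes V :: "'m \<Rightarrow> 'a \<Rightarrow> real ^ 'n"
  assumes "finite F" and "indep_vars (\<lambda>_. borel) V F"
    and "\<And>i s. i \<in> F \<Longrightarrow> s \<in> space M \<Longrightarrow> V i s \<bullet> V i s \<le> c" and c: "0 < c"
    and "\<And>i x. i \<in> F \<Longrightarrow> expectation (\<lambda>s. (V i s \<bullet> x)\<^sup>2) \<le> b i * (x \<bullet> x)"
  shows "expectation (\<lambda>s. trace (mexp_trunc Q (\<Sum>i\<in>F. outer (V i s) (V i s))))
    \<le> real CARD('n) * exp (\<Sum>i\<in>F. (exp c - 1) / c * b i)"
  using assms(1,2,3,5)
proof (induction F rule: finite_induct)
  case empty
  have "eigenbasis (0 :: real ^ 'n ^ 'n) (\<lambda>k. axis k 1) (\<lambda>_. 0)"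
    by (simp add: eigenbasis_def inner_axis_axis)
  from trace_mexp_trunc[OF this, of Q] show ?case
    by (simp add: exp_trunc_0 prob_space)
next
  case (insert i F)
  define A where "A s = (\<Sum>i\<in>F. outer (V i s) (V i s))" for s
  define N where "N s = mexp_trunc Q (A s)" for s
  define u where "u = (exp c - 1) / c"
  define B where "B = (\<chi> a b. expectation (\<lambda>s. V i s $ a * V i s $ b))"
  have u: "0 < u" using c by (simp add: u_def)
  have indep: "indep_vars (\<lambda>_. borel) V F"
    using insert.prems(1) by (rule indep_vars_subset) auto
  have rv: "random_variable borel (V j)" if "j \<in> insert i F" for j
    using insert.prems(1) that unfolding indep_vars_def by blast
  have bV: "bounded_rv (\<lambda>s. V j s $ a)" if "j \<in> insert i F" for j a
    using rv[OF that] insert.prems(2)[OF that] by (rule bounded_rv_component)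
  have bN': "bounded_rv (\<lambda>s. mexp_trunc Q (\<Sum>j\<in>G. outer (V j s) (V j s)) $ a $ b)"
    if "G \<subseteq> insert i F" for G a b
    using that by (intro bounded_rv_sum_outer bV) auto
  have bN: "bounded_rv (\<lambda>s. N s $ a $ b)" for a b
    unfolding N_def A_def by (rule bN') auto
  have btr: "bounded_rv (\<lambda>s. trace (mexp_trunc Q (\<Sum>j\<in>G. outer (V j s) (V j s))))"
    if "G \<subseteq> insert i F" for G
    unfolding trace_def by (intro bounded_rv_sum bN' that)
  have btrN: "bounded_rv (\<lambda>s. trace (N s))"
    unfolding N_def A_def by (rule btr) auto
  have form: "x \<bullet> (C *v x) = (\<Sum>a\<in>UNIV. \<Sum>b\<in>UNIV. C $ a $ b * (x $ a * x $ b))" for x and C :: "real ^ 'n ^ 'n"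
    by (simp add: inner_vec_def matrix_vector_mult_def sum_distrib_left mult_ac)
  have B: "x \<bullet> (B *v x) \<le> b i * (x \<bullet> x)" for x
  proof -
    have "x \<bullet> (B *v x) = expectation (\<lambda>s. \<Sum>a\<in>UNIV. \<Sum>b\<in>UNIV. V i s $ a * V i s $ b * (x $ a * x $ b))"
      unfolding form
      by (subst Bochner_Integration.integral_sum
         | simp add: B_def bounded_rv_integrable bounded_rv_sum bounded_rv_mult bounded_rv_const bV)+
    also have "\<dots> = expectation (\<lambda>s. (V i s \<bullet> x)\<^sup>2)"
      by (simp add: inner_vec_def power2_eq_square sum_product mult_ac)
    also have "\<dots> \<le> b i * (x \<bullet> x)" using insert.prems(3)[of i x] by simp
    finally show ?thesis .
  qed
  \<comment> \<open>Independence of the earlier summands from the new one, entry by entry.\<close>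
  have factor: "expectation (\<lambda>s. N s $ a $ b * (V i s $ a * V i s $ b)) = expectation (\<lambda>s. N s $ a $ b) * B $ a $ b"
    for a b
  proof -
    define f where "f \<omega> = mexp_trunc Q (\<Sum>j\<in>F. outer (\<omega> j) (\<omega> j)) $ a $ b" for \<omega> :: "'m \<Rightarrow> real ^ 'n"
    define g where "g \<omega> = \<omega> i $ a * \<omega> i $ b" for \<omega> :: "'m \<Rightarrow> real ^ 'n"
    have "f \<in> borel_measurable (PiM F (\<lambda>_. borel))"
      unfolding f_def by (rule matrix_function_entries_closed[where C = "\<lambda>f. f \<in> borel_measurable _"])
        (auto simp: outer_def
          intro!: borel_measurable_sum borel_measurable_times borel_measurable_component measurable_component_singleton)
    moreover have "g \<in> borel_measurable (PiM {i} (\<lambda>_. borel))"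
      unfolding g_def by (intro borel_measurable_times borel_measurable_component measurable_component_singleton) auto
    moreover have "indep_var (PiM F (\<lambda>_. borel)) (\<lambda>s. restrict (\<lambda>j. V j s) F)
        (PiM {i} (\<lambda>_. borel)) (\<lambda>s. restrict (\<lambda>j. V j s) {i})"
      using insert.hyps insert.prems(1) by (intro indep_var_restrict[where I = "insert i F"]) auto
    ultimately have "indep_var borel (f \<circ> (\<lambda>s. restrict (\<lambda>j. V j s) F)) borel (g \<circ> (\<lambda>s. restrict (\<lambda>j. V j s) {i}))"
      by (intro indep_var_compose)
    moreover have "f \<circ> (\<lambda>s. restrict (\<lambda>j. V j s) F) = (\<lambda>s. N s $ a $ b)"
      by (simp add: f_def N_def A_def fun_eq_iff)
    moreover have "g \<circ> (\<lambda>s. restrict (\<lambda>j. V j s) {i}) = (\<lambda>s. V i s $ a * V i s $ b)"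
      by (simp add: g_def fun_eq_iff)
    ultimately have "indep_var borel (\<lambda>s. N s $ a $ b) borel (\<lambda>s. V i s $ a * V i s $ b)" by simp
    then show ?thesis
      by (subst indep_var_lebesgue_integral)
        (simp_all add: B_def bounded_rv_integrable bN bounded_rv_mult bV)
  qed
  have bform: "bounded_rv (\<lambda>s. V i s \<bullet> (N s *v V i s))"
    unfolding form by (intro bounded_rv_sum bounded_rv_mult bN bV) auto
  have "expectation (\<lambda>s. V i s \<bullet> (N s *v V i s)) = (\<Sum>a\<in>UNIV. \<Sum>b\<in>UNIV. expectation (\<lambda>s. N s $ a $ b) * B $ a $ b)"
    unfolding form
    by (subst Bochner_Integration.integral_sum
       | simp add: factor bounded_rv_integrable bounded_rv_sum bounded_rv_mult bN bV)+
  also have "\<dots> = expectation (\<lambda>s. \<Sum>a\<in>UNIV. \<Sum>b\<in>UNIV. N s $ a $ b * B $ a $ b)"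
    by (subst Bochner_Integration.integral_sum
       | simp add: bounded_rv_integrable bounded_rv_sum bounded_rv_mult bN bounded_rv_const)+
  also have "\<dots> = expectation (\<lambda>s. trace (N s ** B))"
    by (simp add: trace_def matrix_matrix_mult_def B_def mult.commute)
  also have "\<dots> \<le> expectation (\<lambda>s. b i * trace (N s))"
  proof (rule integral_mono)
    show "integrable M (\<lambda>s. trace (N s ** B))"
      unfolding trace_def matrix_matrix_mult_def
      by (simp add: bounded_rv_integrable bounded_rv_sum bounded_rv_mult bN bounded_rv_const)
    show "integrable M (\<lambda>s. b i * trace (N s))"
      by (intro bounded_rv_integrable bounded_rv_mult bounded_rv_const btrN)
    show "trace (N s ** B) \<le> b i * trace (N s)" for s
      unfolding N_def A_def using psd_sum_outer B by (rule trace_mexp_trunc_mult_le)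
  qed
  finally have form_le: "expectation (\<lambda>s. V i s \<bullet> (N s *v V i s)) \<le> b i * expectation (\<lambda>s. trace (N s))"
    by simp
  have "0 \<le> expectation (\<lambda>s. trace (N s))"
    unfolding N_def A_def by (intro Bochner_Integration.integral_nonneg trace_mexp_trunc_nonneg psd_sum_outer)
  have "expectation (\<lambda>s. trace (mexp_trunc Q (\<Sum>j\<in>insert i F. outer (V j s) (V j s))))
      \<le> expectation (\<lambda>s. trace (N s) + u * (V i s \<bullet> (N s *v V i s)))"
  proof (rule integral_mono)
    show "integrable M (\<lambda>s. trace (mexp_trunc Q (\<Sum>j\<in>insert i F. outer (V j s) (V j s))))"
      by (intro bounded_rv_integrable btr) auto
    show "integrable M (\<lambda>s. trace (N s) + u * (V i s \<bullet> (N s *v V i s)))"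
      by (intro bounded_rv_integrable bounded_rv_add bounded_rv_mult bounded_rv_const btrN bform)
    fix s assume "s \<in> space M"
    then have "V i s \<bullet> V i s \<le> c" using insert.prems(2) by simp
    from trace_mexp_trunc_rank_one_le[OF psd_sum_outer this c, of Q "\<lambda>j. V j s" F]
    show "trace (mexp_trunc Q (\<Sum>j\<in>insert i F. outer (V j s) (V j s)))
        \<le> trace (N s) + u * (V i s \<bullet> (N s *v V i s))"
      using insert.hyps by (simp add: N_def A_def u_def add.commute)
  qed
  also have "\<dots> = expectation (\<lambda>s. trace (N s)) + u * expectation (\<lambda>s. V i s \<bullet> (N s *v V i s))"
    using bounded_rv_integrable[OF btrN] bounded_rv_integrable[OF bform] by simp
  also have "\<dots> \<le> (1 + u * b i) * expectation (\<lambda>s. trace (N s))"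
    using mult_left_mono[OF form_le, of u] u by (simp add: algebra_simps)
  also have "\<dots> \<le> exp (u * b i) * expectation (\<lambda>s. trace (N s))"
    using \<open>0 \<le> expectation (\<lambda>s. trace (N s))\<close> exp_ge_add_one_self by (rule mult_right_mono[rotated])
  also have "\<dots> \<le> exp (u * b i) * (real CARD('n) * exp (\<Sum>j\<in>F. u * b j))"
    using insert.IH[OF indep] insert.prems unfolding N_def A_def u_def by (intro mult_left_mono) auto
  also have "\<dots> = real CARD('n) * exp (\<Sum>j\<in>insert i F. u * b j)"
    using insert.hyps by (simp add: exp_add)
  finally show ?case by (simp add: u_def)
qed

text \<open>
  Markov's inequality for the trace of the truncated exponential, which is at least
  \<open>exp_trunc Q t\<close> on \<open>E\<close>, followed by the limit in \<open>Q\<close>.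
\<close>

theorem rank_one_matrix_chernoff:
  fixes V :: "'m \<Rightarrow> 'a \<Rightarrow> real ^ 'n"
  assumes F: "finite F" and indep: "indep_vars (\<lambda>_. borel) V F"
    and V: "\<And>i s. i \<in> F \<Longrightarrow> s \<in> space M \<Longrightarrow> V i s \<bullet> V i s \<le> c" and c: "0 < c"
    and b: "\<And>i x. i \<in> F \<Longrightarrow> expectation (\<lambda>s. (V i s \<bullet> x)\<^sup>2) \<le> b i * (x \<bullet> x)"
    and t: "0 \<le> t" and E: "E \<in> events"
    and large: "\<And>s. s \<in> E \<Longrightarrow> \<exists>x. t * (x \<bullet> x) < (\<Sum>i\<in>F. (V i s \<bullet> x)\<^sup>2)"
  shows "prob E \<le> real CARD('n) * exp ((exp c - 1) / c * (\<Sum>i\<in>F. b i) - t)"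
proof -
  define T where "T = real CARD('n) * exp (\<Sum>i\<in>F. (exp c - 1) / c * b i)"
  define A where "A s = (\<Sum>i\<in>F. outer (V i s) (V i s))" for s
  have trunc: "exp_trunc Q t * prob E \<le> T" for Q
  proof -
    have "exp_trunc Q t * prob E = expectation (\<lambda>s. exp_trunc Q t * indicator E s)"
      using E by simp
    also have "\<dots> \<le> expectation (\<lambda>s. trace (mexp_trunc Q (A s)))"
    proof (rule integral_mono)
      show "integrable M (\<lambda>s. exp_trunc Q t * indicator E s)"
        using E by (simp add: emeasure_eq_measure)
      have "bounded_rv (\<lambda>s. V i s $ a)" if "i \<in> F" for i a
        using V[OF that] indep that by (intro bounded_rv_component) (auto simp: indep_vars_def)
      then have "bounded_rv (\<lambda>s. mexp_trunc Q (A s) $ a $ b)" for a b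
        unfolding A_def by (rule bounded_rv_sum_outer)
      then show "integrable M (\<lambda>s. trace (mexp_trunc Q (A s)))"
        unfolding trace_def by (intro bounded_rv_integrable bounded_rv_sum)
      fix s
      show "exp_trunc Q t * indicator E s \<le> trace (mexp_trunc Q (A s))"
      proof (cases "s \<in> E")
        case True
        then obtain x where "t * (x \<bullet> x) < (\<Sum>i\<in>F. (V i s \<bullet> x)\<^sup>2)" using large by blast
        then have "exp_trunc Q t \<le> trace (mexp_trunc Q (A s))"
          unfolding A_def by (intro trace_mexp_trunc_ge psd_sum_outer t) (simp add: sum_outer_quadratic_form)
        then show ?thesis using True by simp
      next
        case False
        then show ?thesis
          by (simp add: A_def trace_mexp_trunc_nonneg psd_sum_outer)
      qed
    qed
    also have "\<dots> \<le> T"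
      unfolding T_def A_def by (intro expectation_trace_mexp_trunc_le F indep V c b)
    finally show ?thesis .
  qed
  have "exp t * prob E \<le> T"
    by (rule LIMSEQ_le_const2[OF tendsto_mult_right[OF exp_trunc_limit]]) (auto intro: trunc)
  then have "prob E \<le> T * exp (- t)"
    by (simp add: exp_minus field_simps)
  also have "\<dots> = real CARD('n) * exp ((exp c - 1) / c * (\<Sum>i\<in>F. b i) - t)"
    unfolding T_def sum_distrib_left by (simp add: exp_diff exp_minus field_simps)
  finally show ?thesis .
qed

end

section \<open>The gap between the Hessian and its approximation\<close>

lemma weighted_variance_shift:
  fixes a y :: "'m \<Rightarrow> real"
  assumes "(\<Sum>i\<in>S. a i) = 1"
  shows "(\<Sum>i\<in>S. a i * (y i)\<^sup>2) - (\<Sum>i\<in>S. a i * y i)\<^sup>2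
    = (\<Sum>i\<in>S. a i * (y i - z)\<^sup>2) - ((\<Sum>i\<in>S. a i * y i) - z)\<^sup>2"
proof -
  have "(\<Sum>i\<in>S. a i * (y i - z)\<^sup>2) = (\<Sum>i\<in>S. a i * (y i)\<^sup>2 - 2 * z * (a i * y i) + z\<^sup>2 * a i)"
    by (intro sum.cong refl) (simp add: power2_eq_square algebra_simps)
  also have "\<dots> = (\<Sum>i\<in>S. a i * (y i)\<^sup>2) - 2 * z * (\<Sum>i\<in>S. a i * y i) + z\<^sup>2"
    using assms by (simp add: sum.distrib sum_subtractf flip: sum_distrib_left)
  finally show ?thesis by (simp add: power2_eq_square algebra_simps)
qed

lemma hessian_gap_eq:
  "dr1_hessian w r \<gamma> - scaled_hessian w r \<gamma>
    = (\<Sum>i\<in>UNIV. (w i * r i / (1 - r i)) *\<^sub>R outer (\<gamma> i) (\<gamma> i)) - Omega w r *\<^sub>R outer (xi w r \<gamma>) (xi w r \<gamma>)"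
  by (simp add: dr1_hessian_def scaled_hessian_def)

lemma transpose_hessian_gap:
  "transpose (dr1_hessian w r \<gamma> - scaled_hessian w r \<gamma>) = dr1_hessian w r \<gamma> - scaled_hessian w r \<gamma>"
  unfolding hessian_gap_eq by (simp add: vec_eq_iff transpose_def outer_def mult_ac)

text \<open>
  The quadratic form of the gap is \<open>\<Omega>\<close> times a weighted variance of the numbers \<open>\<gamma> i \<bullet> x\<close>.
\<close>

lemma hessian_gap_form:
  fixes \<gamma> :: "'m::finite \<Rightarrow> real ^ 'n"
  assumes "Omega w r \<noteq> 0"
  shows "x \<bullet> ((dr1_hessian w r \<gamma> - scaled_hessian w r \<gamma>) *v x)
    = Omega w r * ((\<Sum>i\<in>UNIV. omega w r i * (\<gamma> i \<bullet> x)\<^sup>2) - (\<Sum>i\<in>UNIV. omega w r i * (\<gamma> i \<bullet> x))\<^sup>2)"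
proof -
  have xi: "xi w r \<gamma> \<bullet> x = (\<Sum>i\<in>UNIV. omega w r i * (\<gamma> i \<bullet> x))"
    by (simp add: xi_def inner_sum_left)
  have "w i * r i / (1 - r i) = Omega w r * omega w r i" for i
    using assms by (simp add: omega_def)
  then show ?thesis
    unfolding hessian_gap_eq xi[symmetric]
    by (simp add: matrix_vector_mult_diff_rdistrib sum_matrix_vector_mult inner_diff_right inner_sum_right
      outer_mult_vec sum_distrib_left power2_eq_square inner_commute algebra_simps
      flip: scaleR_matrix_vector_assoc)
qed

text \<open>
  Feasibility of the best response alone bounds the bids: entry \<open>j\<close> is the share
  \<open>p $ j * x $ j / w\<close> of the budget spent on good \<open>j\<close>, and these shares sum to \<open>(p \<bullet> x) / w\<close>.
\<close>

lemma best_response_bidding_subprob: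
  assumes "best_response u p w x" "0 < w" "\<And>j. 0 < p $ j"
  shows "0 \<le> bidding p w x $ j" "(\<Sum>j\<in>UNIV. bidding p w x $ j) \<le> 1"
proof -
  have x: "\<And>j. 0 \<le> x $ j" "p \<bullet> x \<le> w"
    using assms(1) by (auto simp: best_response_def is_arg_max_def nonneg_orthant_def)
  have b: "bidding p w x $ j = p $ j * x $ j / w" for j
    by (simp add: bidding_def diag_matrix_def matrix_vector_mult_def if_distrib if_distribR cong: if_cong)
  show "0 \<le> bidding p w x $ j" using x(1)[of j] assms(2) assms(3)[of j] by (simp add: b)
  show "(\<Sum>j\<in>UNIV. bidding p w x $ j) \<le> 1"
    using x(2) assms(2) by (simp add: b inner_vec_def flip: sum_divide_distrib)
qed

text \<open>
  Subprobability vectors have norm at most one, and their inner products are nonnegative.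
\<close>

lemma subprob_dist_sq_le:
  fixes a b :: "real ^ 'n"
  assumes a: "\<And>j. 0 \<le> a $ j" "(\<Sum>j\<in>UNIV. a $ j) \<le> 1" and b: "\<And>j. 0 \<le> b $ j" "(\<Sum>j\<in>UNIV. b $ j) \<le> 1"
  shows "(a - b) \<bullet> (a - b) \<le> 2"
proof -
  have self: "c \<bullet> c \<le> 1" if c: "\<And>j. 0 \<le> c $ j" "(\<Sum>j\<in>UNIV. c $ j) \<le> 1" for c :: "real ^ 'n"
  proof -
    have "c $ j \<le> 1" for j
      using member_le_sum[of j UNIV "\<lambda>j. c $ j"] c by simp
    then have "c \<bullet> c \<le> (\<Sum>j\<in>UNIV. c $ j)"
      unfolding inner_vec_def using c(1) by (intro sum_mono) (simp add: mult_left_le)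
    then show ?thesis using c(2) by simp
  qed
  have "0 \<le> a \<bullet> b" using a(1) b(1) by (auto simp: inner_vec_def intro!: sum_nonneg)
  then show ?thesis using self[OF a] self[OF b] by (simp add: inner_diff_left inner_diff_right inner_commute)
qed

lemma borel_measurable_matrix:
  fixes A :: "'s \<Rightarrow> real ^ 'n ^ 'n"
  assumes "\<And>a b. (\<lambda>s. A s $ a $ b) \<in> borel_measurable N"
  shows "A \<in> borel_measurable N"
  unfolding borel_measurable_euclidean_space[of A]
  using assms by (auto simp: Basis_vec_def inner_axis)

text \<open>
  Gives measurability of the event that a random matrix is positive semidefinite.
\<close>

lemma closed_psd: "closed {A :: real ^ 'n ^ 'n. psd A}"
proof -
  have "psd A \<longleftrightarrow> (\<forall>i j. A $ j $ i = A $ i $ j) \<and> (\<forall>x. 0 \<le> (\<Sum>i\<in>UNIV. x $ i * (\<Sum>j\<in>UNIV. A $ i $ j * x $ j)))"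
    for A :: "real ^ 'n ^ 'n"
    by (simp add: psd_def vec_eq_iff transpose_def inner_vec_def matrix_vector_mult_def)
  then show ?thesis
    by (simp only:)
      (intro closed_Collect_conj closed_Collect_all closed_Collect_eq closed_Collect_le continuous_intros)
qed

lemma ln2_ge_068: "0.68 \<le> ln (2 :: real)"
proof -
  have "exp (0.68 :: real) = exp 0.034 ^ 20"
    by (simp flip: exp_of_nat_mult)
  also have "\<dots> \<le> (1 + 0.034 + 0.034\<^sup>2) ^ 20"
    by (intro power_mono exp_bound) auto
  also have "\<dots> \<le> 2" by (simp add: power2_eq_square power_divide)
  finally show ?thesis by (subst ln_ge_iff) simp_all
qed

text \<open>
  Here \<open>m\<close> is the number of players, \<open>a\<close> the largest eigenvalue of the covariance, \<open>t\<close> its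
  allowance and \<open>l\<close> the logarithm of the inverse failure probability; the conclusion bounds the exponent
  of the matrix Chernoff bound from below. For \<open>0 \<le> a \<le> t\<close> the product
  \<open>(a + t) * (2 * ln 2 * t - a)\<close> is concave in \<open>a\<close>, hence smallest at an end; this end is \<open>a = t\<close>, where it equals
  \<open>2 * (2 * ln 2 - 1) * t\<^sup>2\<close>, about \<open>0.77 * t\<^sup>2\<close>. With the lower bound \<open>0.68\<close> for \<open>ln 2\<close> it is still at least
  \<open>0.72 * t\<^sup>2\<close>, and \<open>0.72 * sqrt 2\<close> exceeds one; the cruder bound \<open>2/3\<close> for \<open>ln 2\<close> would not be
  enough.
\<close>

lemma sample_size_exponent:
  fixes a t c m l :: real
  assumes a: "0 \<le> a" "a \<le> t" and t: "0 < t" and c: "0 < c" and l: "0 \<le> l"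
    and m: "c * (2 * sqrt 2 * (a + t) / t\<^sup>2) * l \<le> m"
  shows "l \<le> m / (2 * c) * (2 * ln 2 * t - a)"
proof -
  have ln2_t: "0.68 * t \<le> ln 2 * t"
    using t by (intro mult_right_mono ln2_ge_068) auto
  have t_le: "t \<le> 2 * ln 2 * t"
    using mult_right_mono[of 1 "2 * ln 2" t] ln2_ge_068 t by simp
  have "0 \<le> (t - a) * (a + 0.64 * t)" using a t by (intro mult_nonneg_nonneg) auto
  moreover have "(a + t) * (1.36 * t - a) - 0.72 * t\<^sup>2 = (t - a) * (a + 0.64 * t)"
    by (simp add: power2_eq_square field_simps)
  ultimately have "0.72 * t\<^sup>2 \<le> (a + t) * (1.36 * t - a)" by linarith
  also have "\<dots> \<le> (a + t) * (2 * ln 2 * t - a)"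
    using a t ln2_t by (intro mult_left_mono) auto
  finally have key: "0.72 * t\<^sup>2 \<le> (a + t) * (2 * ln 2 * t - a)" .
  have "(1.4 :: real) \<le> sqrt 2" by (rule real_le_rsqrt) (simp add: power2_eq_square)
  then have "1.4 * (0.72 * t\<^sup>2) \<le> sqrt 2 * ((a + t) * (2 * ln 2 * t - a))"
    by (intro mult_mono[OF _ key]) auto
  moreover have "t\<^sup>2 \<le> 1.4 * (0.72 * t\<^sup>2)" by simp
  ultimately have "t\<^sup>2 \<le> sqrt 2 * ((a + t) * (2 * ln 2 * t - a))" by linarith
  then have "1 \<le> sqrt 2 * (a + t) / t\<^sup>2 * (2 * ln 2 * t - a)"
    using t by (simp add: field_simps)
  then have "l \<le> l * (sqrt 2 * (a + t) / t\<^sup>2 * (2 * ln 2 * t - a))"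
    using mult_left_mono[OF _ l] by fastforce
  also have "\<dots> = (c * (2 * sqrt 2 * (a + t) / t\<^sup>2) * l) / (2 * c) * (2 * ln 2 * t - a)"
    using c t by (simp add: field_simps)
  also have "\<dots> \<le> m / (2 * c) * (2 * ln 2 * t - a)"
  proof (intro mult_right_mono divide_right_mono m)
    show "0 \<le> 2 * ln 2 * t - a"
      using a t_le by linarith
  qed (use c in simp)
  finally show ?thesis .
qed

theorem theorem4p1:
  fixes M :: "'s measure"
    and p :: "real ^ 'n"
    and w k r :: "'m::finite \<Rightarrow> real"
    and U :: "'m \<Rightarrow> 's \<Rightarrow> real ^ 'n \<Rightarrow> real"
    and X \<gamma> :: "'m \<Rightarrow> 's \<Rightarrow> real ^ 'n"
    and \<Sigma> :: "real ^ 'n ^ 'n"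
    and g C \<kappa> \<epsilon> \<delta> :: real
  assumes prob: "prob_space M"
    and price: "\<And>j. 0 < p $ j"
    and w: "\<And>i. w i = 1 / real CARD('m)"
    and r: "\<And>i. 0 < r i" "\<And>i. r i < 1"
    and d: "\<And>i. 0 < k i * r i"
    and utility: "\<And>i s. s \<in> space M \<Longrightarrow> U i s \<in> utility_class (k i) (r i)"
    and response: "\<And>i s. s \<in> space M \<Longrightarrow> best_response (U i s) p (w i) (X i s)"
    and bids: "\<And>i s. \<gamma> i s = bidding p (w i) (X i s)"
    and indep: "prob_space.indep_vars M (\<lambda>_. borel) X UNIV"
    and ident: "\<And>i j. distr M borel (X i) = distr M borel (X j)"
    and Sigma: "\<And>i. \<Sigma> = covariance_matrix M (\<gamma> i)"
    and g: "0 < g"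
    and C: "0 < C"
    and diminishing: "lambda_max \<Sigma> \<le> C * (1 / real CARD('n) powr g)"
    and spread: "\<And>i. omega w r i \<le> \<kappa> * (1 / real CARD('m))"
    and accuracy: "0 < \<epsilon>"
    and confidence: "0 < \<delta>" "\<delta> < 1"
    and n_large: "real CARD('n) > (2 * C * Omega w r / \<epsilon>) powr (1 / g)"
    and m_large: "real CARD('m) \<ge>
      \<kappa> * (8 * sqrt 2 * ((Omega w r)\<^sup>2 * lambda_max \<Sigma> + 0.5 * Omega w r * \<epsilon>) / \<epsilon>\<^sup>2)
        * ln (2 * real CARD('n) / \<delta>)"
  shows "measure M {s \<in> space M.
      0 \<preceq>\<^sub>L dr1_hessian w r (\<lambda>i. \<gamma> i s) - scaled_hessian w r (\<lambda>i. \<gamma> i s)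
      \<and> dr1_hessian w r (\<lambda>i. \<gamma> i s) - scaled_hessian w r (\<lambda>i. \<gamma> i s) \<preceq>\<^sub>L \<epsilon> *\<^sub>R mat 1}
    \<ge> 1 - \<delta>"
proof -
  interpret prob_space M by (rule prob)
  define m where "m = real CARD('m)"
  define n where "n = real CARD('n)"
  define \<Omega> where "\<Omega> = Omega w r"
  define \<omega> where "\<omega> = omega w r"
  define D where "D s = dr1_hessian w r (\<lambda>i. \<gamma> i s) - scaled_hessian w r (\<lambda>i. \<gamma> i s)" for s
  define \<tau> where "\<tau> = \<epsilon> / (2 * \<Omega>)"
  define \<Lambda> where "\<Lambda> = ln (2 * n / \<delta>)"
  have m: "1 \<le> m" and n: "1 \<le> n" by (simp_all add: m_def n_def Suc_le_eq)
  have term_pos: "0 < w i * r i / (1 - r i)" for i using r[of i] by (simp add: w)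
  have Om: "0 < \<Omega>" unfolding \<Omega>_def Omega_def by (intro sum_pos term_pos) auto
  have om: "0 < \<omega> i" for i
    unfolding \<omega>_def omega_def using Om term_pos by (intro mult_pos_pos) (simp_all add: \<Omega>_def)
  have om_sum: "(\<Sum>i\<in>UNIV. \<omega> i) = 1"
    using Om unfolding \<omega>_def omega_def sum_distrib_left[symmetric] Omega_def[symmetric] \<Omega>_def by simp
  have kap: "0 < \<kappa>"
  proof -
    have "0 < \<kappa> * (1 / m)" using om[of undefined] spread[of undefined] by (simp add: \<omega>_def m_def)
    then show ?thesis using m by (simp add: zero_less_divide_iff)
  qed
  have tau: "0 < \<tau>" using accuracy Om by (simp add: \<tau>_def)

  define h where "h x = bidding p (1 / m) x" for x :: "real ^ 'n"
  have gam: "\<gamma> i s = h (X i s)" for i s by (simp add: bids h_def w m_def)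
  have h_meas: "h \<in> borel_measurable borel"
    unfolding h_def bidding_def
    by (intro borel_measurable_continuous_onI continuous_intros matrix_vector_mult_linear_continuous_on)
  have gam_indep: "indep_vars (\<lambda>_. borel) \<gamma> UNIV"
    using indep_vars_compose2[OF indep, of "\<lambda>_. h" "\<lambda>_. borel"] h_meas by (simp add: gam[abs_def])
  have X_meas: "random_variable borel (X i)" for i
    using indep unfolding indep_vars_def by blast
  have gam_meas: "random_variable borel (\<gamma> i)" for i
    using gam_indep unfolding indep_vars_def by blast
  have gam_nonneg: "0 \<le> \<gamma> i s $ a" and gam_sum: "(\<Sum>a\<in>UNIV. \<gamma> i s $ a) \<le> 1"
    if "s \<in> space M" for i s a
    using best_response_bidding_subprob[OF response[OF that] _ price] by (simp_all add: bids w)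

  define \<mu> where "\<mu> = (\<chi> a. expectation (\<lambda>s. \<gamma> undefined s $ a))"
  \<comment> \<open>Equal distributions of the best responses make the mean bid the same for all players.\<close>
  have gam_mean: "expectation (\<lambda>s. \<gamma> i s $ a) = \<mu> $ a" for i a
  proof -
    have "expectation (\<lambda>s. \<gamma> j s $ a) = (\<integral>x. h x $ a \<partial>distr M borel (X j))" for j
      unfolding gam by (rule integral_distr[symmetric, OF X_meas borel_measurable_component[OF h_meas]])
    from this[of i] this[of undefined] show ?thesis by (simp add: \<mu>_def ident[of i undefined])
  qed
  have gam_bounded: "bounded_rv (\<lambda>s. \<gamma> i s $ a)" for i a
  proof -
    have "\<bar>\<gamma> i s $ a\<bar> \<le> 1" if "s \<in> space M" for s
    proof -
      have "\<gamma> i s $ a \<le> (\<Sum>a\<in>UNIV. \<gamma> i s $ a)"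
        using gam_nonneg[OF that] by (intro member_le_sum) auto
      then show ?thesis using gam_sum[OF that, of i] gam_nonneg[OF that, of i a] by simp
    qed
    then show ?thesis using borel_measurable_component[OF gam_meas] by (auto simp: bounded_rv_def)
  qed
  have mu_nonneg: "0 \<le> \<mu> $ a" for a
    unfolding \<mu>_def by (auto intro!: Bochner_Integration.integral_nonneg_AE AE_I2 gam_nonneg)
  have mu_sum: "(\<Sum>a\<in>UNIV. \<mu> $ a) \<le> 1"
  proof -
    have "(\<Sum>a\<in>UNIV. \<mu> $ a) = expectation (\<lambda>s. \<Sum>a\<in>UNIV. \<gamma> undefined s $ a)"
      by (simp add: \<mu>_def bounded_rv_integrable gam_bounded)
    also have "\<dots> \<le> expectation (\<lambda>_. 1)"
      by (intro integral_mono bounded_rv_integrable bounded_rv_sum bounded_rv_const gam_bounded gam_sum)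
    finally show ?thesis by (simp add: prob_space)
  qed
  have dev_bounded: "bounded_rv (\<lambda>s. (\<gamma> i s - \<mu>) $ a)" for i a
    using bounded_rv_add[OF gam_bounded[of i a] bounded_rv_const[of "- \<mu> $ a"]] by simp
  have Sigma_form: "x \<bullet> (\<Sigma> *v x) = expectation (\<lambda>s. ((\<gamma> i s - \<mu>) \<bullet> x)\<^sup>2)" for i x
  proof -
    have "x \<bullet> (\<Sigma> *v x) = (\<Sum>a\<in>UNIV. \<Sum>b\<in>UNIV. \<Sigma> $ a $ b * (x $ a * x $ b))"
      by (simp add: inner_vec_def matrix_vector_mult_def sum_distrib_left mult_ac)
    also have "\<dots> = (\<Sum>a\<in>UNIV. \<Sum>b\<in>UNIV.
        expectation (\<lambda>s. (\<gamma> i s - \<mu>) $ a * (\<gamma> i s - \<mu>) $ b * (x $ a * x $ b)))"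
      by (simp add: Sigma[of i] covariance_matrix_def gam_mean)
    also have "\<dots> = expectation (\<lambda>s. \<Sum>a\<in>UNIV. \<Sum>b\<in>UNIV.
        (\<gamma> i s - \<mu>) $ a * (\<gamma> i s - \<mu>) $ b * (x $ a * x $ b))"
      using dev_bounded
      by (subst Bochner_Integration.integral_sum
         | simp add: bounded_rv_integrable bounded_rv_sum bounded_rv_mult bounded_rv_const
             del: vector_minus_component)+
    also have "\<dots> = expectation (\<lambda>s. ((\<gamma> i s - \<mu>) \<bullet> x)\<^sup>2)"
      by (simp add: inner_vec_def power2_eq_square sum_product mult_ac)
    finally show ?thesis .
  qed
  have Sigma_sym: "transpose \<Sigma> = \<Sigma>"
    by (simp add: Sigma[of undefined] covariance_matrix_def vec_eq_iff transpose_def mult.commute)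
  have "psd \<Sigma>"
    unfolding psd_def by (simp add: Sigma_sym Sigma_form[of _ undefined])
  define lam where "lam = lambda_max \<Sigma>"
  have lam_nonneg: "0 \<le> lam" unfolding lam_def using \<open>psd \<Sigma>\<close> by (rule lambda_max_nonneg)
  have lam_form: "expectation (\<lambda>s. ((\<gamma> i s - \<mu>) \<bullet> x)\<^sup>2) \<le> lam * (x \<bullet> x)" for i x
    unfolding lam_def Sigma_form[symmetric] by (rule quadratic_form_le_lambda_max[OF Sigma_sym])
  have lam_le: "lam \<le> \<tau>"
  proof -
    have "2 * C * \<Omega> / \<epsilon> = ((2 * C * \<Omega> / \<epsilon>) powr (1 / g)) powr g"
      using g C Om accuracy by (simp add: powr_powr)
    also have "\<dots> < n powr g"
      using n_large g by (intro powr_less_mono2) (auto simp: n_def \<Omega>_def)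
    finally have "C * (1 / n powr g) \<le> \<tau>"
      using Om accuracy n by (simp add: \<tau>_def field_simps)
    then show ?thesis using diminishing by (simp add: lam_def n_def)
  qed

  \<comment> \<open>Centring at \<open>\<mu>\<close> leaves a square to be dropped, which makes the summands independent.\<close>
  have D_form: "x \<bullet> (D s *v x) = \<Omega> * ((\<Sum>i\<in>UNIV. \<omega> i * ((\<gamma> i s - \<mu>) \<bullet> x)\<^sup>2)
      - ((\<Sum>i\<in>UNIV. \<omega> i * (\<gamma> i s \<bullet> x)) - \<mu> \<bullet> x)\<^sup>2)" for s x
    using hessian_gap_form[of w r x "\<lambda>i. \<gamma> i s"] weighted_variance_shift[OF om_sum, of "\<lambda>i. \<gamma> i s \<bullet> x" "\<mu> \<bullet> x"] Om
    by (simp add: D_def \<Omega>_def \<omega>_def inner_diff_left)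
  \<comment> \<open>Centring at the weighted mean itself leaves only nonnegative terms.\<close>
  have D_nonneg: "0 \<le> x \<bullet> (D s *v x)" for s x
  proof -
    have "x \<bullet> (D s *v x) = \<Omega> * (\<Sum>i\<in>UNIV. \<omega> i * (\<gamma> i s \<bullet> x - (\<Sum>j\<in>UNIV. \<omega> j * (\<gamma> j s \<bullet> x)))\<^sup>2)"
      using hessian_gap_form[of w r x "\<lambda>i. \<gamma> i s"] Om
        weighted_variance_shift[OF om_sum, of "\<lambda>i. \<gamma> i s \<bullet> x" "\<Sum>j\<in>UNIV. \<omega> j * (\<gamma> j s \<bullet> x)"]
      by (simp add: D_def \<Omega>_def \<omega>_def)
    also have "0 \<le> \<dots>" using Om om by (intro mult_nonneg_nonneg sum_nonneg) (auto intro: less_imp_le)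
    finally show ?thesis .
  qed
  have D_sym: "transpose (D s) = D s" for s
    unfolding D_def by (rule transpose_hessian_gap)
  have gap_sym: "transpose (\<epsilon> *\<^sub>R mat 1 - D s) = \<epsilon> *\<^sub>R mat 1 - D s" for s
  proof -
    have "D s $ b $ a = D s $ a $ b" for a b
      using D_sym[of s] by (metis (no_types) transpose_def vec_lambda_beta)
    then show ?thesis by (simp add: vec_eq_iff transpose_def mat_def)
  qed
  define G where "G = {s \<in> space M. psd (\<epsilon> *\<^sub>R mat 1 - D s)}"
  have good: "{s \<in> space M. 0 \<preceq>\<^sub>L D s \<and> D s \<preceq>\<^sub>L \<epsilon> *\<^sub>R mat 1} = G"
    using D_nonneg D_sym by (auto simp: G_def loewner_le_def psd_def)
  have G_event: "G \<in> events"
  proof -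
    have "(\<lambda>s. \<epsilon> *\<^sub>R mat 1 - D s) \<in> borel_measurable M"
    proof (rule borel_measurable_matrix)
      fix a b
      have "(\<lambda>s. D s $ a $ b) \<in> borel_measurable M"
        unfolding D_def hessian_gap_eq outer_def xi_def
        using borel_measurable_component[OF gam_meas] by simp
      then show "(\<lambda>s. (\<epsilon> *\<^sub>R mat 1 - D s) $ a $ b) \<in> borel_measurable M" by simp
    qed
    from measurable_sets[OF this borel_closed[OF closed_psd]] show ?thesis
      by (simp add: G_def vimage_def Int_def conj_commute)
  qed

  \<comment> \<open>The factor \<open>q\<close> scales the summands of \<open>S\<close> to squared norm at most \<open>ln 2\<close>: the weights are at most \<open>\<kappa> / m\<close> and the squared deviations at most \<open>2\<close>.\<close>
  define q where "q = ln 2 * m / (2 * \<kappa>)"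
  have q: "0 < q" using m kap by (simp add: q_def)
  define V where "V i s = sqrt (\<omega> i * q) *\<^sub>R (\<gamma> i s - \<mu>)" for i s
  have V_form: "(V i s \<bullet> x)\<^sup>2 = \<omega> i * q * ((\<gamma> i s - \<mu>) \<bullet> x)\<^sup>2" for i s x
    using om[of i] q by (simp add: V_def power_mult_distrib)
  have V_indep: "indep_vars (\<lambda>_. borel) V UNIV"
    using indep_vars_compose2[OF gam_indep, of "\<lambda>i y. sqrt (\<omega> i * q) *\<^sub>R (y - \<mu>)" "\<lambda>_. borel"]
    by (simp add: V_def[abs_def])
  \<comment> \<open>The threshold \<open>\<epsilon> / \<Omega> = 2 * \<tau>\<close> for \<open>S\<close> is scaled by \<open>q\<close> as well.\<close>
  have "prob (space M - G) \<le> n * exp ((exp (ln 2) - 1) / ln 2 * (\<Sum>i\<in>UNIV. \<omega> i * q * lam) - 2 * q * \<tau>)"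
    unfolding n_def
  proof (rule rank_one_matrix_chernoff[OF _ V_indep])
    fix i s assume s: "s \<in> space M"
    have "V i s \<bullet> V i s = \<omega> i * q * ((\<gamma> i s - \<mu>) \<bullet> (\<gamma> i s - \<mu>))"
      using om[of i] q by (simp add: V_def)
    also have "\<dots> \<le> (\<kappa> * (1 / m)) * q * 2"
    proof (intro mult_mono subprob_dist_sq_le gam_nonneg gam_sum s mu_nonneg mu_sum)
      show "\<omega> i \<le> \<kappa> * (1 / m)" using spread by (simp add: \<omega>_def m_def)
    qed (use kap m q in auto)
    also have "\<dots> = ln 2" using kap m by (simp add: q_def)
    finally show "V i s \<bullet> V i s \<le> ln 2" .
  next
    fix i and x :: "real ^ 'n"
    show "expectation (\<lambda>s. (V i s \<bullet> x)\<^sup>2) \<le> \<omega> i * q * lam * (x \<bullet> x)"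
      using mult_left_mono[OF lam_form[of i x], of "\<omega> i * q"] om[of i] q
      by (simp add: V_form mult.assoc)
  next
    fix s assume "s \<in> space M - G"
    then obtain x where "\<not> 0 \<le> x \<bullet> ((\<epsilon> *\<^sub>R mat 1 - D s) *v x)"
      using gap_sym by (auto simp: G_def psd_def)
    then have "\<epsilon> * (x \<bullet> x) < x \<bullet> (D s *v x)"
      by (simp add: matrix_vector_mult_diff_rdistrib inner_diff_right flip: scaleR_matrix_vector_assoc)
    also have "\<dots> \<le> \<Omega> * (\<Sum>i\<in>UNIV. \<omega> i * ((\<gamma> i s - \<mu>) \<bullet> x)\<^sup>2)"
      unfolding D_form using Om by (intro mult_left_mono) auto
    finally have "q / \<Omega> * (\<epsilon> * (x \<bullet> x)) < q / \<Omega> * (\<Omega> * (\<Sum>i\<in>UNIV. \<omega> i * ((\<gamma> i s - \<mu>) \<bullet> x)\<^sup>2))"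
      using q Om by (intro mult_strict_left_mono) auto
    also have "\<dots> = (\<Sum>i\<in>UNIV. (V i s \<bullet> x)\<^sup>2)"
      using Om by (simp add: V_form sum_distrib_left mult_ac)
    finally have "2 * q * \<tau> * (x \<bullet> x) < (\<Sum>i\<in>UNIV. (V i s \<bullet> x)\<^sup>2)"
      using Om by (simp add: \<tau>_def)
    then show "\<exists>x. 2 * q * \<tau> * (x \<bullet> x) < (\<Sum>i\<in>UNIV. (V i s \<bullet> x)\<^sup>2)" ..
  qed (use q tau G_event in auto)
  also have "(exp (ln 2) - 1) / ln 2 * (\<Sum>i\<in>UNIV. \<omega> i * q * lam) - 2 * q * \<tau>
      = - (m / (2 * \<kappa>) * (2 * ln 2 * \<tau> - lam))"
    unfolding sum_distrib_right[symmetric] om_sum using kap by (simp add: q_def field_simps)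
  also have "n * exp (- (m / (2 * \<kappa>) * (2 * ln 2 * \<tau> - lam))) \<le> n * exp (- \<Lambda>)"
  proof -
    have "8 * sqrt 2 * (\<Omega>\<^sup>2 * lam + 0.5 * \<Omega> * \<epsilon>) / \<epsilon>\<^sup>2 = 2 * sqrt 2 * (lam + \<tau>) / \<tau>\<^sup>2"
      using accuracy Om by (simp add: \<tau>_def power2_eq_square field_simps)
    then have "\<kappa> * (2 * sqrt 2 * (lam + \<tau>) / \<tau>\<^sup>2) * \<Lambda> \<le> m"
      using m_large by (simp add: m_def \<Lambda>_def n_def lam_def \<Omega>_def)
    moreover have "0 \<le> \<Lambda>" using n confidence by (simp add: \<Lambda>_def field_simps)
    ultimately have "\<Lambda> \<le> m / (2 * \<kappa>) * (2 * ln 2 * \<tau> - lam)"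
      using lam_nonneg lam_le tau kap by (intro sample_size_exponent)
    then show ?thesis using n by simp
  qed
  also have "\<dots> = \<delta> / 2"
    using n confidence by (simp add: \<Lambda>_def exp_minus)
  finally have "prob (space M - G) \<le> \<delta>" using confidence by simp
  then have "1 - \<delta> \<le> prob G"
    using prob_compl[OF G_event] by simp
  then show ?thesis
    unfolding good[symmetric] D_def .
qed

end
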